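(* Let $\omega$ be a probability distribution on $(0,1)$ such that: (i) $\omega$ is not supported by a geometric sequence, i.e. there is no $x\in(0,1)$ with $\omega(\{1-x^j:j=1,2,\ldots\})=1$; (ii) $\int_0^1|\log x|\,\omega(\mathrm{d}x)<\infty$; (iii) $\nu:=\int_0^1(\log(1-x))^2\,\omega(\mathrm{d}x)<\infty$. Put $\mu:=\int_0^1|\log(1-x)|\,\omega(\mathrm{d}x)$ and $a_n=\mathbb{E}K_n$. Then, as $n\to\infty$, $$a_n=\frac{\log n}{\mu}+\frac{\gamma}{\mu}+b+o(1),\qquad\text{where}\quad b=\frac1\mu\int_0^1\log x\,\omega(\mathrm{d}x)+\frac{\nu}{2\mu^2}$$ and $\gamma$ is the Euler constant.
   Context: Definition of $K_n$: let $X_1,X_2,\ldots$ be i.i.d. with distribution $\omega$, and let $U_1,U_2,\ldots$ be i.i.d. uniform on $[0,1]$, independent of $(X_j)$. Put $P_0=0$ and $P_j=1-\prod_{i=1}^j(1-X_i)$. Then $K_n$ is the number of $j\ge1$ such that the interval $(P_{j-1},P_j)$ contains at least one of $U_1,\ldots,U_n$. *)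

theory Defs
  imports "HOL-Probability.Probability" "HOL-Library.Landau_Symbols"
begin

text \<open>Sequences are indexed from 1; the values \<open>x 0\<close> and \<open>u 0\<close> are never used.\<close>

definition stick_point :: "(nat \<Rightarrow> real) \<Rightarrow> nat \<Rightarrow> real" where
  "stick_point x j = 1 - (\<Prod>i=1..j. 1 - x i)"

text \<open>
  For \<open>x i \<in> {0<..<1}\<close> the intervals are disjoint, so the set below has at most \<open>n\<close>
  elements. It can be infinite, with \<open>card\<close> returning 0, only if some \<open>x i\<close> lies outside
  \<open>{0<..<1}\<close>, which is a null event for the random sequences considered.
\<close>

definition num_occupied :: "(nat \<Rightarrow> real) \<Rightarrow> (nat \<Rightarrow> real) \<Rightarrow> nat \<Rightarrow> nat" where
  "num_occupied x u n =
     card {j. 1 \<le> j \<and> (\<exists>i\<in>{1..n}. u i \<in> {stick_point x (j - 1)<..<stick_point x j})}"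

end

theory Submission
  imports Defs "HOL-Real_Asymp.Real_Asymp"
begin

text \<open>
  Put \<open>\<xi> = - ln (1 - X)\<close> and let \<open>S\<close> be the random walk with independent steps distributed as
  \<open>\<xi>\<close>. The \<open>j\<close>-th interval has length \<open>p\<^sub>j = exp (- S\<^sub>j\<^sub>-\<^sub>1) * X\<^sub>j\<close>, and given the intervals it is
  occupied with probability \<open>1 - (1 - p\<^sub>j)^n\<close>. Replacing this by \<open>1 - exp (- n * p\<^sub>j)\<close> changes it by
  a factor between \<open>1\<close> and \<open>1 + 2/n\<close> (\<open>power_exp_sandwich\<close>). Hence \<open>a\<^sub>n\<close> may be replaced by
  \<open>A (ln n)\<close>, where \<open>h t\<close> is the mean of \<open>1 - exp (- exp t * X)\<close> and
  \<open>A t = (\<Sum>j. E (h (t - S\<^sub>j)))\<close> solves the renewal equation \<open>A t = h t + E (A (t - \<xi>))\<close>. Below,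
  \<open>h\<close> is called \<open>hit_prob\<close> and \<open>A\<close> is called \<open>poisson_mean\<close>, since it is the mean number of
  occupied intervals when the number of points is Poisson with mean \<open>exp t\<close>.

  Three observations determine \<open>A\<close> up to \<open>o(1)\<close>.

  First, \<open>h t - E (h (t - \<xi>)) \<ge> E X * h' t\<close> by convexity of the exponential function. Summing the left
  side along the walk telescopes to \<open>h t \<le> 1\<close>, so \<open>A\<close> is Lipschitz with constant \<open>1 / E X\<close>
  (\<open>poisson_mean_lipschitz\<close>).

  Second, integrating the renewal equation over \<open>{..t}\<close> shows that the mean of
  \<open>\<integral>s\<in>{0..\<xi>}. A (t - s)\<close> is \<open>H t = (\<integral>s\<in>{..t}. h s)\<close>, that is,
  \<open>\<mu> * A t = H t + E (\<integral>s\<in>{0..\<xi>}. A t - A (t - s))\<close> (\<open>lag_deficit_identity\<close>). Here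
  \<open>H t = t + \<gamma> + E (ln X) + o(1)\<close>, where Euler's constant enters through
  \<open>(\<integral>s\<in>{..u}. 1 - exp (- exp s)) = u + \<gamma> + o(1)\<close> (\<open>Phi_asymp\<close>). The Lipschitz bound and the finite
  second moment keep the last term bounded, so \<open>A t = t / \<mu> + O(1)\<close>.

  Third, the increments satisfy \<open>A (t + d) - A t \<longlongrightarrow> d / \<mu>\<close> (\<open>blackwell\<close>). With this, dominated convergence
  in the identity above turns the last term into \<open>E (\<xi>\<^sup>2) / (2 * \<mu>) = \<nu> / (2 * \<mu>)\<close>, and
  dividing by \<open>\<mu>\<close> gives the expansion.

  The third step is where \<open>\<omega>\<close> has to be nongeometric. The increment \<open>f t = A (t + d) - A t\<close> is bounded,
  Lipschitz and asymptotically harmonic: \<open>f t - E (f (t - \<xi>)) \<longlongrightarrow> 0\<close>. Let \<open>\<eta>\<close> be its limit superior, attained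
  along times \<open>t\<^sub>n\<close>. An average can only be close to its maximum if almost all values are, so
  \<open>f (t\<^sub>n - x) \<longlonglongrightarrow> \<eta>\<close> for every \<open>x\<close> in the support of \<open>\<xi>\<close>, and then for every finite sum of
  such \<open>x\<close>. If \<open>\<xi>\<close> is nonlattice, these sums come arbitrarily close to
  all points of some arithmetic progression with step \<open>d\<close> and prescribed length. Along the progression the
  increments add up to one long increment of \<open>A\<close>, which is its length over \<open>\<mu>\<close> up to \<open>O(1)\<close>; hence
  \<open>\<eta> \<le> d / \<mu>\<close>. The same argument for \<open>- f\<close> bounds the limit inferior (\<open>limsup_le_average\<close>).
\<close>


section \<open>Euler's constant as an exponential integral\<close>

text \<open>
  Both bounds compare \<open>1 - p\<close> with \<open>exp (- p)\<close> for \<open>p = y / n\<close>: it is at most \<open>exp (- p)\<close> and at least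
  \<open>(1 - p\<^sup>2) * exp (- p)\<close>. Bernoulli's inequality makes the relative loss at most \<open>y\<^sup>2 / n\<close>, which the
  factor \<open>exp (- y)\<close> turns into at most \<open>2 * (1 - exp (- y)) / n\<close>. An error relative to
  \<open>1 - exp (- y)\<close> is what survives summation over infinitely many intervals.
\<close>

lemma power_exp_sandwich:
  fixes y :: real and n :: nat
  assumes "0 \<le> y" "y \<le> real n" "0 < n"
  shows "1 - exp (- y) \<le> 1 - (1 - y / n) ^ n"
    and "1 - (1 - y / n) ^ n \<le> (1 + 2 / n) * (1 - exp (- y))"
proof -
  define p where "p = y / n"
  have p: "0 \<le> p" "p \<le> 1" using assms by (auto simp: p_def)
  have y: "y = real n * p" using assms by (simp add: p_def)
  have "(1 - p) ^ n \<le> exp (- p) ^ n"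
    using p exp_ge_add_one_self[of "-p"] by (intro power_mono) auto
  also have "\<dots> = exp (- y)" by (simp add: y flip: exp_of_nat_mult)
  finally show "1 - exp (- y) \<le> 1 - (1 - y / n) ^ n" by (simp add: p_def)
  have "exp (- y) * (1 - n * p\<^sup>2) \<le> (1 - p) ^ n"
  proof -
    have "1 - n * p\<^sup>2 = 1 + real n * (- p\<^sup>2)" by simp
    also have "\<dots> \<le> (1 + - p\<^sup>2) ^ n"
      using p by (intro Bernoulli_inequality) (simp add: power_le_one)
    also have "\<dots> \<le> (exp p * (1 - p)) ^ n"
    proof (rule power_mono)
      have "(1 + p) * (1 - p) \<le> exp p * (1 - p)"
        using p exp_ge_add_one_self[of p] by (intro mult_right_mono) auto
      then show "1 + - p\<^sup>2 \<le> exp p * (1 - p)" by (simp add: algebra_simps power2_eq_square)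
      show "0 \<le> 1 + - p\<^sup>2" using p by (simp add: power_le_one)
    qed
    also have "\<dots> = exp y * (1 - p) ^ n" by (simp add: y power_mult_distrib flip: exp_of_nat_mult)
    finally have "exp (- y) * (1 - n * p\<^sup>2) \<le> exp (- y) * (exp y * (1 - p) ^ n)"
      by (intro mult_left_mono) auto
    also have "\<dots> = (1 - p) ^ n" by (simp add: exp_minus)
    finally show ?thesis .
  qed
  moreover have "exp (- y) * (n * p\<^sup>2) \<le> 2 / n * (1 - exp (- y))"
  proof -
    have "y\<^sup>2 / 2 \<le> exp y - 1" using exp_lower_Taylor_quadratic[of y] assms by simp
    then have "exp (- y) * (y\<^sup>2 / 2) \<le> exp (- y) * (exp y - 1)" by (intro mult_left_mono) auto
    also have "\<dots> = 1 - exp (- y)" by (simp add: algebra_simps flip: exp_add)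
    finally have "2 / n * (exp (- y) * (y\<^sup>2 / 2)) \<le> 2 / n * (1 - exp (- y))"
      by (intro mult_left_mono) auto
    then show ?thesis using assms(3) by (simp add: y power2_eq_square mult_ac)
  qed
  ultimately show "1 - (1 - y / n) ^ n \<le> (1 + 2 / n) * (1 - exp (- y))"
    by (simp add: p_def algebra_simps)
qed

lemma nn_integral_FTC_atMost:
  fixes f F :: "real \<Rightarrow> real"
  assumes [measurable]: "f \<in> borel_measurable borel"
    and deriv: "\<And>s. s \<le> u \<Longrightarrow> (F has_real_derivative f s) (at s)"
    and nonneg: "\<And>s. s \<le> u \<Longrightarrow> 0 \<le> f s" and lim: "(F \<longlongrightarrow> T) at_bot"
  shows "(\<integral>\<^sup>+s. ennreal (f s) * indicator {..u} s \<partial>lborel) = ennreal (F u - T)"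
proof -
  have "(\<integral>\<^sup>+s. ennreal (f s) * indicator {..u} s \<partial>lborel)
    = (\<integral>\<^sup>+s. ennreal (f (0 + (-1) * s)) * indicator {..u} (0 + (-1) * s) \<partial>lborel)"
    by (subst nn_integral_real_affine[where c="-1" and t=0]) auto
  also have "\<dots> = (\<integral>\<^sup>+s. ennreal (f (- s)) * indicator {-u..} s \<partial>lborel)"
    by (intro nn_integral_cong) (auto simp: indicator_def)
  also have "\<dots> = ennreal (- T - - F (- (- u)))"
  proof (rule nn_integral_FTC_atLeast)
    fix s assume s: "- u \<le> s"
    have "((\<lambda>s. - F (- s)) has_real_derivative - (f (- s) * (- 1))) (at s)"
      by (rule DERIV_minus DERIV_chain2[OF deriv] derivative_eq_intros refl | use s in simp)+
    then show "((\<lambda>s. - F (- s)) has_real_derivative f (- s)) (at s)" by simp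
    show "0 \<le> f (- s)" using s nonneg by simp
  next
    show "((\<lambda>s. - F (- s)) \<longlongrightarrow> - T) at_top"
      by (intro tendsto_minus filterlim_compose[OF lim] filterlim_uminus_at_bot_at_top)
  qed simp
  finally show ?thesis by simp
qed

text \<open>
  In the variable \<open>v = exp s\<close> this is the integral of \<open>(1 - exp (- v)) / v\<close> from \<open>0\<close> to \<open>exp u\<close>,
  that is, the entire exponential integral at \<open>exp u\<close>.
\<close>

definition Phi :: "real \<Rightarrow> real" where
  "Phi u = enn2real (\<integral>\<^sup>+s. ennreal (1 - exp (- exp s)) * indicator {..u} s \<partial>lborel)"

lemma nn_integral_exp_atMost:
  "(\<integral>\<^sup>+s. ennreal (exp s) * indicator {..u} s \<partial>lborel) = ennreal (exp u)"
  using nn_integral_FTC_atMost[of exp u exp 0] by (auto intro!: derivative_eq_intros exp_at_bot)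

lemma Phi_nn:
  "(\<integral>\<^sup>+s. ennreal (1 - exp (- exp s)) * indicator {..u} s \<partial>lborel) = ennreal (Phi u)" (is "?I = _")
  and Phi_le_exp: "Phi u \<le> exp u"
proof -
  have "?I \<le> (\<integral>\<^sup>+s. ennreal (exp s) * indicator {..u} s \<partial>lborel)"
  proof (intro nn_integral_mono mult_right_mono ennreal_leI)
    show "1 - exp (- exp s) \<le> exp s" for s :: real
      using exp_ge_add_one_self[of "- exp s"] by linarith
  qed simp
  then have le: "?I \<le> ennreal (exp u)" by (simp add: nn_integral_exp_atMost)
  then have "?I < \<top>" by (meson ennreal_less_top le_less_trans)
  then show *: "?I = ennreal (Phi u)" by (simp add: Phi_def)
  show "Phi u \<le> exp u" using le unfolding * by (simp add: ennreal_le_iff)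
qed

lemma Phi_nonneg: "0 \<le> Phi u" by (simp add: Phi_def)

lemma Phi_mono: "u \<le> v \<Longrightarrow> Phi u \<le> Phi v"
proof -
  assume "u \<le> v"
  then have "ennreal (Phi u) \<le> ennreal (Phi v)"
    unfolding Phi_nn[symmetric] by (intro nn_integral_mono) (auto simp: indicator_def)
  then show ?thesis by (simp add: Phi_nonneg)
qed

lemma Phi_measurable [measurable]: "Phi \<in> borel_measurable borel"
  by (intro borel_measurable_mono monoI Phi_mono)

text \<open>
  The integrand is at most \<open>1\<close>, so \<open>Phi u - u\<close> is decreasing. This extends the limit from the
  points \<open>ln n\<close> to all real \<open>u\<close>.
\<close>

lemma Phi_increment: "u \<le> v \<Longrightarrow> Phi v \<le> Phi u + (v - u)"
proof -
  assume "u \<le> v"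
  have "ennreal (Phi v) \<le> (\<integral>\<^sup>+s. ennreal (1 - exp (- exp s)) * indicator {..u} s
      + indicator {u..v} s \<partial>lborel)"
    unfolding Phi_nn[symmetric] 
    by (intro nn_integral_mono) (auto simp: indicator_def  intro!: ennreal_leI)
  also have "\<dots> = ennreal (Phi u) + ennreal (v - u)"
    using \<open>u \<le> v\<close> by (subst nn_integral_add) (auto simp: Phi_nn)
  finally show ?thesis using \<open>u \<le> v\<close> by (simp add: Phi_nonneg flip: ennreal_plus)
qed

text \<open>
  In the variable \<open>w = 1 - exp s / n\<close> this is the classical integral of \<open>(1 - w^n) / (1 - w)\<close>, a
  geometric sum, over the unit interval.
\<close>

lemma harm_integral:
  assumes "0 < n"
  shows "(\<integral>\<^sup>+s. ennreal (1 - (1 - exp s / real n) ^ n) * indicator {..ln n} s \<partial>lborel) = ennreal (harm n)"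
proof -
  define F where "F s = - (\<Sum>k=1..n. (1 - exp s / real n) ^ k / real k)" for s
  have n: "1 - exp s / real n \<ge> 0" "1 - exp s / real n \<le> 1" if "s \<le> ln n" for s :: real
    using that assms by (auto simp: field_simps ln_ge_iff)
  have "(\<integral>\<^sup>+s. ennreal (1 - (1 - exp s / real n) ^ n) * indicator {..ln n} s \<partial>lborel)
      = ennreal (F (ln n) - (- harm n))"
  proof (rule nn_integral_FTC_atMost)
    fix s :: real assume s: "s \<le> ln n"
    show "0 \<le> 1 - (1 - exp s / real n) ^ n" using n[OF s] by (simp add: power_le_one)
    let ?w = "1 - exp s / real n"
    have "(F has_real_derivative - (\<Sum>k=1..n. - (exp s / real n) * ?w ^ (k - 1))) (at s)"
      unfolding F_def using assms
      by (auto intro!: derivative_eq_intros sum.cong)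
    also have "- (\<Sum>k=1..n. - (exp s / real n) * ?w ^ (k - 1)) = (1 - ?w) * (\<Sum>k=1..n. ?w ^ (k - 1))"
      by (simp add: sum_distrib_left sum_negf)
    also have "(\<Sum>k=1..n. ?w ^ (k - 1)) = (\<Sum>k<n. ?w ^ k)"
      by (rule sum.reindex_bij_witness[of _ Suc "\<lambda>k. k - 1"]) auto
    also have "(1 - ?w) * \<dots> = 1 - ?w ^ n" by (rule one_diff_power_eq[symmetric])
    finally show "(F has_real_derivative (1 - ?w ^ n)) (at s)" .
  next
    have "(F \<longlongrightarrow> - (\<Sum>k=1..n. (1 - 0 / real n) ^ k / real k)) at_bot"
      unfolding F_def using assms by (intro tendsto_intros exp_at_bot) auto
    then show "(F \<longlongrightarrow> - harm n) at_bot" by (simp add: harm_def divide_inverse)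
  qed simp
  also have "F (ln n) = 0" using assms by (simp add: F_def power_0_left)
  finally show ?thesis by simp
qed

lemma Phi_ln_sandwich:
  assumes "0 < n"
  shows "Phi (ln n) \<le> harm n" "harm n \<le> (1 + 2 / n) * Phi (ln n)"
proof -
  have e: "0 \<le> exp s" "exp s \<le> real n" if "s \<le> ln n" for s using that assms by (auto simp: ln_ge_iff)
  have hp: "0 \<le> (harm n :: real)" by (simp add: harm_nonneg)
  have "ennreal (Phi (ln n)) \<le> ennreal (harm n)"
    unfolding Phi_nn[symmetric] harm_integral[OF assms, symmetric]
    using power_exp_sandwich(1)[OF e assms]
    by (intro nn_integral_mono) (auto simp: indicator_def intro!: ennreal_leI)
  then show "Phi (ln n) \<le> harm n" using hp by simp
  define c where "c = 1 + 2 / real n"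
  have c: "0 \<le> c" by (simp add: c_def)
  have "ennreal (harm n) \<le> (\<integral>\<^sup>+s. ennreal c * (ennreal (1 - exp (- exp s)) * indicator {..ln n} s) \<partial>lborel)"
    unfolding harm_integral[OF assms, symmetric]
    using power_exp_sandwich(2)[OF e assms] c
    by (intro nn_integral_mono)
       (auto simp: indicator_def c_def[symmetric] ennreal_mult[symmetric] intro!: ennreal_leI)
  also have "\<dots> = ennreal (c * Phi (ln n))"
    using c by (subst nn_integral_cmult) (auto simp: Phi_nn ennreal_mult Phi_nonneg)
  finally show "harm n \<le> (1 + 2 / n) * Phi (ln n)" using hp c
    by (simp add: ennreal_le_iff Phi_nonneg c_def)
qed

lemma Phi_ge: "u + euler_mascheroni \<le> Phi u"
  and Phi_asymp: "((\<lambda>u. Phi u - u) \<longlongrightarrow> euler_mascheroni) at_top"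
proof -
  have euler: "(\<lambda>n. harm n - ln (of_nat n)) \<longlonglongrightarrow> (euler_mascheroni :: real)"
    by (rule euler_mascheroni_LIMSEQ)
  have lower: "(\<lambda>n. harm n - ln (real n) - 2 / n * harm n) \<longlonglongrightarrow> (euler_mascheroni :: real) - 0"
  proof (rule tendsto_diff[OF euler])
    have "(\<lambda>n. 2 / n * (harm n - ln (real n)) + 2 / n * ln n) \<longlonglongrightarrow> 0 * (euler_mascheroni :: real) + 0"
      by (intro tendsto_add tendsto_mult euler) real_asymp+
    then show "(\<lambda>n. 2 / n * harm n) \<longlonglongrightarrow> (0::real)" by (simp add: right_diff_distrib diff_divide_distrib)
  qed
  have lim: "(\<lambda>n. Phi (ln (real n)) - ln (real n)) \<longlonglongrightarrow> (euler_mascheroni :: real)"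
  proof (rule tendsto_sandwich)
    show "\<forall>\<^sub>F n in sequentially. harm n - ln (real n) - 2 / n * harm n \<le> Phi (ln n) - ln (real n)"
    proof (rule eventually_mono[OF eventually_gt_at_top[of 0]])
      fix n :: nat assume n: "0 < n"
      have "2 / n * Phi (ln n) \<le> 2 / n * harm n" using Phi_ln_sandwich(1)[OF n] by (intro mult_left_mono) auto
      with Phi_ln_sandwich(2)[OF n] show "harm n - ln (real n) - 2 / n * harm n \<le> Phi (ln n) - ln (real n)"
        by (simp add: algebra_simps)
    qed
    show "\<forall>\<^sub>F n in sequentially. Phi (ln n) - ln (real n) \<le> harm n - ln (real n)"
      by (rule eventually_mono[OF eventually_gt_at_top[of 0]]) (use Phi_ln_sandwich(1) in auto)
    show "(\<lambda>n. harm n - ln (real n)) \<longlonglongrightarrow> (euler_mascheroni :: real)" by (rule euler)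
  qed (use lower in simp)
  show ge: "u + euler_mascheroni \<le> Phi u" for u
  proof -
    have "\<forall>\<^sub>F n in sequentially. Phi (ln n) - ln (real n) \<le> Phi u - u"
    proof -
      have "filterlim (\<lambda>n. ln (real n)) at_top sequentially" by real_asymp
      then have "\<forall>\<^sub>F n in sequentially. u \<le> ln (real n)" by (simp add: filterlim_at_top)
      then show ?thesis by eventually_elim (use Phi_increment in \<open>force simp: algebra_simps\<close>)
    qed
    from tendsto_upperbound[OF lim this] show ?thesis by simp
  qed
  show "((\<lambda>u. Phi u - u) \<longlongrightarrow> euler_mascheroni) at_top"
  proof (rule order_tendstoI)
    fix e :: real assume "e < euler_mascheroni"
    then show "\<forall>\<^sub>F u in at_top. e < Phi u - u" using ge by (intro always_eventually) (smt (verit))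
  next
    fix e :: real assume "euler_mascheroni < e"
    then obtain N where N: "Phi (ln (real N)) - ln (real N) < e"
      using eventually_happens'[OF sequentially_bot order_tendstoD(2)[OF lim]] by blast
    show "\<forall>\<^sub>F u in at_top. Phi u - u < e"
      using eventually_ge_at_top[of "ln (real N)"]
          by eventually_elim (use N Phi_increment in \<open>force simp: algebra_simps\<close>)
  qed
qed

lemma Phi_le: "Phi u \<le> 1 + max 0 u"
proof (cases "u \<le> 0")
  case True
  then have "Phi u \<le> exp u" "exp u \<le> 1" using Phi_le_exp by auto
  then show ?thesis by linarith
next
  case False
  then show ?thesis using Phi_increment[of 0 u] Phi_le_exp[of 0] by simp
qed

section \<open>Asymptotically harmonic functions of nonlattice distributions\<close>

text \<open>
  \<open>\<eta>\<close> is the infimum over \<open>n\<close> of the suprema over \<open>{n..}\<close>, and \<open>t n\<close> nearly realizes the supremum over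
  \<open>{n..}\<close>.
\<close>

lemma ex_seq_tendsto_limsup:
  fixes f :: "real \<Rightarrow> real"
  assumes bd: "\<And>t. \<bar>f t\<bar> \<le> B"
  shows "\<exists>\<eta> t. filterlim t at_top sequentially \<and> (\<lambda>n::nat. f (t n)) \<longlonglongrightarrow> \<eta> \<and>
    (\<forall>e>0. \<forall>\<^sub>F s in at_top. f s < \<eta> + e)"
proof -
  define g where "g T = (SUP s\<in>{T..}. f s)" for T
  define \<eta> where "\<eta> = (INF n::nat. g (real n))"
  have bdd: "bdd_above (f ` S)" for S using bd by (intro bdd_aboveI[of _ B]) (auto simp: abs_le_iff)
  have f_le: "f s \<le> g T" if "T \<le> s" for s T
    unfolding g_def using that bdd by (intro cSUP_upper) auto
  have g_ge: "- B \<le> g T" for T using f_le[of T T] bd[of T] by linarith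
  have bddb: "bdd_below (range (\<lambda>n::nat. g (real n)))" using g_ge by (intro bdd_belowI) auto
  have up: "\<forall>\<^sub>F s in at_top. f s < \<eta> + e" if "0 < e" for e
  proof -
    have "(INF n::nat. g (real n)) < \<eta> + e" using that by (simp add: \<eta>_def)
    then obtain n :: nat where n: "g (real n) < \<eta> + e"
      using cINF_less_iff[OF _ bddb] by blast
    show ?thesis using eventually_ge_at_top[of "real n"]
      by eventually_elim (use n f_le in \<open>force intro: le_less_trans\<close>)
  qed
  have "\<exists>s\<ge>real n. \<eta> - 1 / (real n + 1) < f s" for n :: nat
  proof -
    have "\<eta> \<le> g (real n)" unfolding \<eta>_def by (intro cINF_lower bddb) auto
    then have "\<eta> - 1 / (real n + 1) < g (real n)" by (smt (verit) divide_pos_pos of_nat_0_le_iff)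
    then show ?thesis unfolding g_def using bdd less_cSUP_iff[of "{real n..}" f] by auto
  qed
  then obtain t where t: "\<And>n. real n \<le> t n" "\<And>n. \<eta> - 1 / (real n + 1) < f (t n)" by metis
  have lim: "filterlim t at_top sequentially"
    by (rule filterlim_at_top_mono[OF filterlim_real_sequentially]) (use t in auto)
  have "(\<lambda>n. f (t n)) \<longlonglongrightarrow> \<eta>"
  proof (rule order_tendstoI)
    fix a assume "a < \<eta>"
    have "(\<lambda>n. \<eta> - 1 / (real n + 1)) \<longlonglongrightarrow> \<eta>" by real_asymp
    from order_tendstoD(1)[OF this \<open>a < \<eta>\<close>] show "\<forall>\<^sub>F n in sequentially. a < f (t n)"
      by eventually_elim (use t(2) in \<open>force intro: less_trans\<close>)
  next
    fix a assume "\<eta> < a"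
    then have "\<forall>\<^sub>F s in at_top. f s < \<eta> + (a - \<eta>)" by (intro up) simp
    from eventually_compose_filterlim[OF this lim] show "\<forall>\<^sub>F n in sequentially. f (t n) < a" by simp
  qed
  with lim up show ?thesis by blast
qed

definition topological_support :: "real measure \<Rightarrow> real set" where
  "topological_support F = {x. \<forall>r>0. 0 < measure F {x - r<..<x + r}}"

text \<open>
  The complement of the support is covered by the countably many null intervals with rational endpoints.
\<close>

lemma AE_topological_support:
  fixes M :: "real measure"
  assumes "prob_space M" and [measurable_cong]: "sets M = sets borel"
  shows "AE x in M. x \<in> topological_support M"
proof -
  interpret prob_space M by fact
  have "AE x in M. \<forall>p\<in>\<rat>. \<forall>q\<in>\<rat>. measure M {p<..<q} = 0 \<longrightarrow> x \<notin> {p<..<q}"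
  proof (intro AE_ball_countable' countable_rat AE_impI)
    fix p q :: real assume "measure M {p<..<q} = 0"
    then have "{p<..<q} \<in> null_sets M" by (intro null_setsI) (simp_all add: emeasure_eq_measure)
    then show "AE x in M. x \<notin> {p<..<q}" by (rule AE_not_in)
  qed
  then show ?thesis
  proof eventually_elim
    case (elim x)
    show ?case unfolding topological_support_def
    proof safe
      fix r :: real assume "0 < r"
      obtain p where p: "p \<in> \<rat>" "x - r < p" "p < x" using Rats_dense_in_real[of "x - r" x] \<open>0 < r\<close> by auto
      obtain q where q: "q \<in> \<rat>" "x < q" "q < x + r" using Rats_dense_in_real[of x "x + r"] \<open>0 < r\<close> by auto
      have "0 < measure M {p<..<q}" using elim p q by (auto simp: less_le)
      also have "\<dots> \<le> measure M {x - r<..<x + r}" using p q by (intro finite_measure_mono) auto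
      finally show "0 < measure M {x - r<..<x + r}" .
    qed
  qed
qed

text \<open>
  The differences of elements of \<open>C\<close> form a subgroup of the reals. A subgroup without arbitrarily small
  positive elements has a least positive element, and division with remainder shows that this element
  generates it.
\<close>

lemma add_closed_small_gaps_or_lattice:
  fixes C :: "real set"
  assumes zero: "0 \<in> C" and add: "\<And>x y. x \<in> C \<Longrightarrow> y \<in> C \<Longrightarrow> x + y \<in> C"
  shows "(\<forall>e>0. \<exists>a\<in>C. \<exists>b\<in>C. 0 < b - a \<and> b - a < e) \<or> (\<exists>c>0. \<forall>x\<in>C. \<exists>k::int. x = c * of_int k)"
proof (rule disjCI)
  define D where "D = {b - a | a b. a \<in> C \<and> b \<in> C}"
  have DC: "x \<in> D" if "x \<in> C" for x using that zero by (force simp: D_def)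
  have Dm: "x - y \<in> D" if "x \<in> D" "y \<in> D" for x y
  proof -
    obtain a b a' b' where "x = b - a" "y = b' - a'" "a \<in> C" "b \<in> C" "a' \<in> C" "b' \<in> C"
      using \<open>x \<in> D\<close> \<open>y \<in> D\<close> by (auto simp: D_def)
    then have "x - y = (b + a') - (a + b')" "b + a' \<in> C" "a + b' \<in> C" using add by auto
    then show ?thesis unfolding D_def by blast
  qed
  have D0: "0 \<in> D" using DC zero by simp
  have Dn: "- x \<in> D" if "x \<in> D" for x using Dm[OF D0 that] by simp
  have Da: "x + y \<in> D" if "x \<in> D" "y \<in> D" for x y using Dm[OF that(1) Dn[OF that(2)]] by simp
  have Dnat: "of_nat k * x \<in> D" if "x \<in> D" for x and k :: nat
    by (induction k) (auto simp: D0 algebra_simps intro: Da that)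
  have Dint: "of_int k * x \<in> D" if "x \<in> D" for x and k :: int
    using Dnat[OF that, of "nat k"] Dn[OF Dnat[OF that, of "nat (- k)"]] by (cases "0 \<le> k") auto
  assume nl: "\<not> (\<exists>c>0. \<forall>x\<in>C. \<exists>k::int. x = c * of_int k)"
  show "\<forall>e>0. \<exists>a\<in>C. \<exists>b\<in>C. 0 < b - a \<and> b - a < e"
  proof (rule ccontr)
    assume "\<not> ?thesis"
    then obtain e where e: "0 < e" and no: "\<And>d. d \<in> D \<Longrightarrow> 0 < d \<Longrightarrow> e \<le> d"
      by (force simp: D_def)
    define P where "P = {d \<in> D. 0 < d}"
    have "\<exists>x\<in>C. x \<noteq> 0"
    proof (rule ccontr)
      assume "\<not> (\<exists>x\<in>C. x \<noteq> 0)"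
      then have "\<forall>x\<in>C. \<exists>k::int. x = 1 * of_int k" by (metis mult_1 of_int_0)
      with nl show False using zero_less_one by blast
    qed
    then obtain x where x: "x \<in> C" "x \<noteq> 0" by blast
    then have "\<bar>x\<bar> \<in> P" using DC[OF x(1)] Dn[OF DC[OF x(1)]] by (auto simp: P_def abs_if)
    then have ne: "P \<noteq> {}" by blast
    have bdd: "bdd_below P" by (rule bdd_belowI[of _ 0]) (auto simp: P_def)
    define c where "c = Inf P"
    have c_le: "c \<le> d" if "d \<in> P" for d unfolding c_def by (rule cInf_lower[OF that bdd])
    obtain d where d: "d \<in> P" "d < c + e" using cInf_lessD[OF ne, of "c + e"] e by (auto simp: c_def)
    have "d \<le> c" unfolding c_def
    proof (rule cInf_greatest[OF ne], rule ccontr)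
      fix y assume y: "y \<in> P" "\<not> d \<le> y"
      then have "e \<le> d - y" using d by (intro no Dm) (auto simp: P_def)
      then show False using c_le[OF y(1)] d by simp
    qed
    then have dc: "d = c" using c_le[OF d(1)] by simp
    then have c: "0 < c" "c \<in> D" using d by (auto simp: P_def)
    have "\<exists>k::int. x = c * of_int k" if "x \<in> C" for x
    proof -
      let ?r = "x - of_int \<lfloor>x / c\<rfloor> * c"
      have "?r \<in> D" using Dm[OF DC[OF that] Dint[OF c(2)]] .
      moreover have "0 \<le> ?r" "?r < c" 
        using c(1) floor_divide_lower[of c x] floor_divide_upper[of c x] by (auto simp: algebra_simps)
      ultimately have "?r = 0" using c_le[of ?r] by (force simp: P_def)
      then show ?thesis by (intro exI[of _ "\<lfloor>x / c\<rfloor>"]) (simp add: mult.commute)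
    qed
    with nl c show False by blast
  qed
qed

text \<open>
  For the increments of a solution of a renewal equation whose inhomogeneity converges at infinity, the
  defect \<open>f t - \<integral>s. f (t - s) \<partial>F\<close> tends to \<open>0\<close>.
\<close>

locale renewal_limit = prob_space F for F :: "real measure" +
  fixes f :: "real \<Rightarrow> real" and B L :: real
  assumes sets_F [measurable_cong]: "sets F = sets borel"
    and bounded: "\<bar>f t\<bar> \<le> B"
    and lipschitz: "\<bar>f t - f s\<bar> \<le> L * \<bar>t - s\<bar>"
    and asymp_harmonic: "((\<lambda>t. f t - (\<integral>s. f (t - s) \<partial>F)) \<longlongrightarrow> 0) at_top"
begin

lemma L_nonneg: "0 \<le> L" using order_trans[OF abs_ge_zero lipschitz[of 1 0]] by simp

lemma f_measurable [measurable]: "f \<in> borel_measurable borel"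
proof -
  have "L-lipschitz_on UNIV f"
    by (intro lipschitz_onI) (auto simp: dist_real_def lipschitz L_nonneg)
  then have "continuous_on UNIV f" by (rule lipschitz_on_continuous_on)
  then show ?thesis by (rule borel_measurable_continuous_onI)
qed

text \<open>
  The means of \<open>f (t n - s)\<close> tend to \<open>\<eta>\<close>, while the excess over \<open>\<eta>\<close> vanishes in the limit; so the
  shortfall \<open>v n s\<close> has vanishing mean too. If \<open>f (t n - x)\<close> fell below \<open>\<eta>\<close> by a fixed amount,
  the Lipschitz bound would spread the shortfall over a neighbourhood of \<open>x\<close>, which has positive mass.
\<close>

lemma limsup_propagates:
  assumes up: "\<And>e. 0 < e \<Longrightarrow> \<forall>\<^sub>F s in at_top. f s < \<eta> + e"
    and t: "filterlim t at_top sequentially" "(\<lambda>n::nat. f (t n)) \<longlonglongrightarrow> \<eta>"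
    and x: "x \<in> topological_support F"
  shows "(\<lambda>n. f (t n - x)) \<longlonglongrightarrow> \<eta>"
proof -
  have shift: "filterlim (\<lambda>n. t n - s) at_top sequentially" for s
    using filterlim_tendsto_add_at_top[OF tendsto_const t(1), of "- s"] by simp
  have up': "\<forall>\<^sub>F n in sequentially. f (t n - s) < \<eta> + e" if "0 < e" for s e
    using eventually_compose_filterlim[OF up[OF that] shift] .
  have int: "integrable F (\<lambda>s. f (t n - s))" for n
    by (rule integrable_const_bound[of _ B]) (auto simp: bounded)
  define v where "v n s = max 0 (\<eta> - f (t n - s))" for n s
  have v_le: "\<bar>v n s\<bar> \<le> \<bar>\<eta>\<bar> + B" for n s using bounded[of "t n - s"] by (auto simp: v_def)
  have v_meas [measurable]: "v n \<in> borel_measurable F" for n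
    unfolding v_def[abs_def] by measurable
  have v_int: "integrable F (v n)" for n
    by (rule integrable_const_bound[of _ "\<bar>\<eta>\<bar> + B"]) (simp_all add: v_le)
  have excess: "(\<lambda>n. \<integral>s. v n s - (\<eta> - f (t n - s)) \<partial>F) \<longlonglongrightarrow> (\<integral>s. 0 \<partial>F)"
  proof (rule integral_dominated_convergence[where w="\<lambda>_. 2 * (\<bar>\<eta>\<bar> + B)"])
    show "AE s in F. (\<lambda>n. v n s - (\<eta> - f (t n - s))) \<longlonglongrightarrow> 0"
    proof (intro AE_I2 tendstoI)
      fix s e :: real assume "0 < e"
      from up'[OF this, of s] show "\<forall>\<^sub>F n in sequentially. dist (v n s - (\<eta> - f (t n - s))) 0 < e"
        by eventually_elim (use \<open>0 < e\<close> in \<open>auto simp: v_def dist_real_def max_def\<close>)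
    qed
    show "AE s in F. norm (v n s - (\<eta> - f (t n - s))) \<le> 2 * (\<bar>\<eta>\<bar> + B)" for n
    proof (intro AE_I2)
      show "norm (v n s - (\<eta> - f (t n - s))) \<le> 2 * (\<bar>\<eta>\<bar> + B)" for s
      proof -
        have "\<bar>v n s - (\<eta> - f (t n - s))\<bar> \<le> \<bar>v n s\<bar> + (\<bar>\<eta>\<bar> + \<bar>f (t n - s)\<bar>)"
          using abs_triangle_ineq4[of "v n s" "\<eta> - f (t n - s)"] abs_triangle_ineq4[of \<eta> "f (t n - s)"]
          by (rule order.trans[OF _ add_left_mono])
        also have "\<dots> \<le> (\<bar>\<eta>\<bar> + B) + (\<bar>\<eta>\<bar> + B)" by (intro add_mono v_le bounded order.refl)
        finally show ?thesis by simp
      qed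
    qed
    show "(\<lambda>s. v n s - (\<eta> - f (t n - s))) \<in> borel_measurable F" for n by measurable
    show "(\<lambda>s. 0::real) \<in> borel_measurable F" by measurable
    show "integrable F (\<lambda>_. 2 * (\<bar>\<eta>\<bar> + B))" by (rule integrable_const)
  qed
  have mean: "(\<lambda>n. \<eta> - (\<integral>s. f (t n - s) \<partial>F)) \<longlonglongrightarrow> \<eta> - \<eta>"
  proof (rule tendsto_diff[OF tendsto_const])
    have "(\<lambda>n. f (t n) - (f (t n) - (\<integral>s. f (t n - s) \<partial>F))) \<longlonglongrightarrow> \<eta> - 0"
      by (intro tendsto_diff t(2) filterlim_compose[OF asymp_harmonic t(1)])
    then show "(\<lambda>n. \<integral>s. f (t n - s) \<partial>F) \<longlonglongrightarrow> \<eta>" by simp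
  qed
  have "(\<lambda>n. (\<integral>s. v n s - (\<eta> - f (t n - s)) \<partial>F) + (\<eta> - (\<integral>s. f (t n - s) \<partial>F))) \<longlonglongrightarrow> 0"
    using tendsto_add[OF excess mean] by (simp only: Bochner_Integration.integral_zero diff_self add_0)
  moreover have "(\<integral>s. v n s - (\<eta> - f (t n - s)) \<partial>F) = (\<integral>s. v n s \<partial>F) - (\<eta> - (\<integral>s. f (t n - s) \<partial>F))" for n
    using int v_int by (simp add: prob_space)
  ultimately have v0: "(\<lambda>n. \<integral>s. v n s \<partial>F) \<longlonglongrightarrow> 0" by simp
  have low: "\<forall>\<^sub>F n in sequentially. \<eta> - e < f (t n - x)" if "0 < e" for e
  proof -
    \<comment> \<open>Over the window \<open>?S\<close> below, \<open>f\<close> changes by at most \<open>e / 2\<close>; \<open>L + 1\<close> avoids division by \<open>0\<close>.\<close>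
    define r where "r = e / (2 * (L + 1))"
    have r: "0 < r" "L * r \<le> e / 2" using that L_nonneg by (auto simp: r_def field_simps)
    let ?S = "{x - r<..<x + r}"
    define p where "p = measure F ?S"
    have p: "0 < p" using x r by (simp add: topological_support_def p_def)
    have key: "p * (\<eta> - f (t n - x) - L * r) \<le> (\<integral>s. v n s \<partial>F)" for n
    proof -
      have "p * (\<eta> - f (t n - x) - L * r) = (\<integral>s. (\<eta> - f (t n - x) - L * r) * indicator ?S s \<partial>F)"
        by (simp add: p_def)
      also have "\<dots> \<le> (\<integral>s. v n s \<partial>F)"
      proof (rule integral_mono[OF _ v_int])
        show "integrable F (\<lambda>s. (\<eta> - f (t n - x) - L * r) * indicator ?S s)"
            by (simp add: less_top[symmetric])
        fix s assume "s \<in> space F"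
        have "L * \<bar>(t n - s) - (t n - x)\<bar> \<le> L * r" if "s \<in> ?S"
          using that L_nonneg by (intro mult_left_mono) auto
        then show "(\<eta> - f (t n - x) - L * r) * indicator ?S s \<le> v n s"
          using lipschitz[of "t n - s" "t n - x"] by (auto simp: v_def indicator_def)
      qed
      finally show ?thesis .
    qed
    have "0 < p * (e / 2)" using p that by simp
    from order_tendstoD(2)[OF v0 this] show ?thesis
    proof eventually_elim
      case (elim n)
      then have "p * (\<eta> - f (t n - x) - L * r) < p * (e / 2)" using key by (rule order.strict_trans1[rotated])
      then show ?case using p r by simp
    qed
  qed
  show ?thesis
  proof (rule order_tendstoI)
    show "\<forall>\<^sub>F n in sequentially. a < f (t n - x)" if "a < \<eta>" for a using low[of "\<eta> - a"] that by simp
    show "\<forall>\<^sub>F n in sequentially. f (t n - x) < a" if "\<eta> < a" for a using up'[of "a - \<eta>" x] that by simp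
  qed
qed

text \<open>
  The shifts \<open>x\<close> for which \<open>f (t n - x)\<close> inherits the limit \<open>\<eta>\<close> form an additive set, because
  \<open>t n - x\<close> is again an admissible sequence of times. Two elements \<open>a\<close>, \<open>b\<close> of this set with small
  difference give the equally spaced elements \<open>(k - j) * a + j * b\<close> for \<open>j \<le> k\<close>, fine enough and, for
  large \<open>k\<close>, numerous enough to approximate a progression with step \<open>d\<close> and \<open>N\<close> terms. So
  \<open>f\<close> is close to \<open>\<eta>\<close> on the whole progression, and its average there is at most \<open>c + K / N\<close>.
\<close>

theorem limsup_le_average:
  assumes nonlattice: "\<And>c. 0 < c \<Longrightarrow> \<not> (AE x in F. \<exists>k::int. x = c * of_int k)"
    and d: "0 < d"
    and avg: "\<And>N. \<forall>\<^sub>F t in at_top. (\<Sum>i<N. f (t - real i * d)) \<le> real N * c + K"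
    and e: "0 < e"
  shows "\<forall>\<^sub>F t in at_top. f t < c + e"
proof -
  obtain \<eta> t where t: "filterlim t at_top sequentially" "(\<lambda>n::nat. f (t n)) \<longlonglongrightarrow> \<eta>"
    and up: "\<And>e. 0 < e \<Longrightarrow> \<forall>\<^sub>F s in at_top. f s < \<eta> + e"
    using ex_seq_tendsto_limsup[of f B, OF bounded] by blast
  define C where "C = {x. \<forall>t. filterlim t at_top sequentially \<longrightarrow> (\<lambda>n::nat. f (t n)) \<longlonglongrightarrow> \<eta>
    \<longrightarrow> (\<lambda>n. f (t n - x)) \<longlonglongrightarrow> \<eta>}"
  have shift: "filterlim (\<lambda>n. u n - s) at_top sequentially" if "filterlim u at_top sequentially" for u ::
      "nat \<Rightarrow> real" and s
    using filterlim_tendsto_add_at_top[OF tendsto_const that, of "- s"] by simp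
  have supp: "topological_support F \<subseteq> C" using limsup_propagates[OF up] by (auto simp: C_def)
  have C0: "0 \<in> C" by (simp add: C_def)
  have Cadd: "x + y \<in> C" if "x \<in> C" "y \<in> C" for x y
    unfolding C_def
  proof safe
    fix u :: "nat \<Rightarrow> real" assume u: "filterlim u at_top sequentially" "(\<lambda>n. f (u n)) \<longlonglongrightarrow> \<eta>"
    have "(\<lambda>n. f (u n - x)) \<longlonglongrightarrow> \<eta>" using that u by (auto simp: C_def)
    then have "(\<lambda>n. f ((u n - x) - y)) \<longlonglongrightarrow> \<eta>" using that shift[OF u(1)] by (auto simp: C_def)
    then show "(\<lambda>n. f (u n - (x + y))) \<longlonglongrightarrow> \<eta>" by (simp add: algebra_simps)
  qed
  have Cmult: "of_nat k * x \<in> C" if "x \<in> C" for x and k :: nat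
    by (induction k) (auto simp: C0 algebra_simps intro: Cadd that)
  have gaps: "\<exists>a\<in>C. \<exists>b\<in>C. 0 < b - a \<and> b - a < e" if "0 < e" for e
  proof -
    have "\<not> (\<exists>c>0. \<forall>x\<in>C. \<exists>k::int. x = c * of_int k)"
    proof safe
      fix c :: real assume c: "0 < c" and "\<forall>x\<in>C. \<exists>k::int. x = c * of_int k"
      then have "AE x in F. \<exists>k::int. x = c * of_int k"
        using AE_topological_support[OF prob_space_axioms sets_F] supp by (auto elim!: eventually_mono)
      with nonlattice[OF c] show False by blast
    qed
    then show ?thesis using add_closed_small_gaps_or_lattice[OF C0 Cadd] that by blast
  qed
  have grid: "real N * (\<eta> - 2 * r) \<le> real N * c + K" if r: "0 < r" for N r
  proof -
    define h where "h = r / (L + 1)"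
    have h: "0 < h" "L * h \<le> r" using r L_nonneg by (auto simp: h_def field_simps)
    obtain a b where ab: "a \<in> C" "b \<in> C" "0 < b - a" "b - a < h" using gaps[OF h(1)] by blast
    \<comment> \<open>\<open>z i\<close> is the largest of the points \<open>(k - j) * a + j * b\<close> not exceeding \<open>k * a + i * d\<close>.\<close>
    define j where "j i = nat \<lfloor>real i * d / (b - a)\<rfloor>" for i :: nat
    define k where "k = j N"
    define z where "z i = real (k - j i) * a + real (j i) * b" for i
    have z: "z i \<in> C" "\<bar>z i - (real k * a + real i * d)\<bar> \<le> h" if "i < N" for i
    proof -
      show "z i \<in> C" unfolding z_def using ab by (intro Cadd Cmult)
      have "j i \<le> k" unfolding j_def k_def using that ab d
          by (intro nat_mono floor_mono divide_right_mono mult_right_mono) auto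
      then have "z i - (real k * a + real i * d) = real (j i) * (b - a) - real i * d"
        by (simp add: z_def of_nat_diff algebra_simps)
      moreover have "real (j i) = of_int \<lfloor>real i * d / (b - a)\<rfloor>" using ab d by (simp add: j_def)
      moreover have "of_int \<lfloor>real i * d / (b - a)\<rfloor> * (b - a) \<le> real i * d"
        "real i * d < (of_int \<lfloor>real i * d / (b - a)\<rfloor> + 1) * (b - a)"
        using ab floor_divide_lower[of "b - a" "real i * d"] floor_divide_upper[of "b - a" "real i * d"]
            by auto
      ultimately show "\<bar>z i - (real k * a + real i * d)\<bar> \<le> h"
        using ab by (simp add: algebra_simps)
    qed
    have "\<forall>\<^sub>F n in sequentially. \<forall>i\<in>{..<N}. \<eta> - r < f (t n - z i)"
    proof (subst eventually_ball_finite_distrib, simp, intro ballI)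
      fix i assume "i \<in> {..<N}"
      then have "(\<lambda>n. f (t n - z i)) \<longlonglongrightarrow> \<eta>" using z(1) t by (auto simp: C_def)
      from order_tendstoD(1)[OF this] r show "\<forall>\<^sub>F n in sequentially. \<eta> - r < f (t n - z i)" by simp
    qed
    moreover have "\<forall>\<^sub>F n in sequentially. (\<Sum>i<N. f (t n - real k * a - real i * d)) \<le> real N * c + K"
      using eventually_compose_filterlim[OF avg shift[OF t(1)]] .
    ultimately have "\<forall>\<^sub>F n in sequentially. real N * (\<eta> - 2 * r) \<le> real N * c + K"
    proof eventually_elim
      case (elim n)
      have "(\<Sum>i<N. \<eta> - 2 * r) \<le> (\<Sum>i<N. f (t n - real k * a - real i * d))"
      proof (rule sum_mono)
        fix i assume i: "i \<in> {..<N}"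
        have "\<bar>f (t n - z i) - f (t n - real k * a - real i * d)\<bar> \<le> L * \<bar>z i - (real k * a + real i * d)\<bar>"
          using lipschitz[of "t n - z i" "t n - real k * a - real i * d"]
              by (simp add: algebra_simps abs_minus_commute)
        also have "\<dots> \<le> L * h" using z(2) i L_nonneg by (intro mult_left_mono) auto
        finally show "\<eta> - 2 * r \<le> f (t n - real k * a - real i * d)" using elim(1) i h by force
      qed
      then show ?case using elim(2) by simp
    qed
    then show ?thesis by simp
  qed
  have "\<eta> \<le> c"
  proof (rule ccontr)
    assume "\<not> \<eta> \<le> c"
    \<comment> \<open>With this tolerance \<open>\<eta> - 2 * r\<close> is the midpoint of \<open>c\<close> and \<open>\<eta>\<close>.\<close>
    define r where "r = (\<eta> - c) / 4"
    have r: "0 < r" using \<open>\<not> \<eta> \<le> c\<close> by (simp add: r_def)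
    obtain N :: nat where N: "K / (2 * r) < real N" using reals_Archimedean2 by blast
    have "real N * (\<eta> - 2 * r) = real N * c + real N * (2 * r)" by (simp add: r_def algebra_simps)
    then have "real N * (2 * r) \<le> K" using grid[OF r, of N] by simp
    with N r show False by (simp add: field_simps)
  qed
  then show ?thesis using up[OF e] by (auto elim!: eventually_mono)
qed

end

section \<open>The Poissonized mean and its renewal equation\<close>

text \<open>
  Everything is written in terms of \<open>t = ln n\<close>, in which a break with fraction \<open>x\<close> acts on the
  remaining stick as the translation by \<open>ln (1 - x)\<close>.
\<close>

locale stick_law = prob_space \<omega> for \<omega> :: "real measure" +
  assumes sets_\<omega> [measurable_cong]: "sets \<omega> = sets borel"
    and unit: "AE x in \<omega>. 0 < x \<and> x < 1"
begin

lemma space_\<omega> [simp]: "space \<omega> = UNIV"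
  using sets_eq_imp_space_eq[OF sets_\<omega>] by simp

lemma AE_unit: "(\<And>x. 0 < x \<Longrightarrow> x < 1 \<Longrightarrow> P x) \<Longrightarrow> AE x in \<omega>. P x"
  using unit by (rule eventually_mono) auto

lemma emeasure_UNIV [simp]: "emeasure \<omega> UNIV = 1" and prob_UNIV [simp]: "measure \<omega> UNIV = 1"
  using emeasure_space_1 prob_space by simp_all

text \<open>
  Extended nonnegative functions allow iterates and infinite sums without integrability conditions; the
  real-valued counterparts follow once finiteness is known.
\<close>

definition step_mean :: "(real \<Rightarrow> ennreal) \<Rightarrow> real \<Rightarrow> ennreal" where
  "step_mean f t = (\<integral>\<^sup>+x. f (t + ln (1 - x)) \<partial>\<omega>)"

definition hit_prob_nn :: "real \<Rightarrow> ennreal" where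
  "hit_prob_nn t = (\<integral>\<^sup>+x. ennreal (1 - exp (- (exp t * x))) \<partial>\<omega>)"

definition poisson_mean_nn :: "real \<Rightarrow> ennreal" where
  "poisson_mean_nn t = (\<Sum>j. (step_mean ^^ j) hit_prob_nn t)"

definition mean_X :: real where "mean_X = (\<integral>x. x \<partial>\<omega>)"

lemma step_mean_measurable [measurable]:
  assumes [measurable]: "f \<in> borel_measurable borel"
  shows "step_mean f \<in> borel_measurable borel"
  unfolding step_mean_def[abs_def] by measurable

lemma iterate_measurable [measurable]: "f \<in> borel_measurable borel
    \<Longrightarrow> (step_mean ^^ j) f \<in> borel_measurable borel"
  by (induction j) auto

lemma hit_prob_nn_measurable [measurable]: "hit_prob_nn \<in> borel_measurable borel"
  unfolding hit_prob_nn_def[abs_def] by measurable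

lemma poisson_mean_nn_measurable [measurable]: "poisson_mean_nn \<in> borel_measurable borel"
  unfolding poisson_mean_nn_def[abs_def] by measurable

lemma iterate_mono:
  assumes "\<And>t. f t \<le> g t"
  shows "(step_mean ^^ j) f t \<le> (step_mean ^^ j) g t"
  using assms by (induction j arbitrary: t) (auto simp: step_mean_def intro: nn_integral_mono)

lemma iterate_add:
  assumes [measurable]: "f \<in> borel_measurable borel" "g \<in> borel_measurable borel"
  shows "(step_mean ^^ j) (\<lambda>t. f t + g t) = (\<lambda>t. (step_mean ^^ j) f t + (step_mean ^^ j) g t)"
proof (induction j)
  case (Suc j)
  have "step_mean (\<lambda>t. (step_mean ^^ j) f t + (step_mean ^^ j) g t) u
      = step_mean ((step_mean ^^ j) f) u + step_mean ((step_mean ^^ j) g) u" for u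
    unfolding step_mean_def[of _ u] by (rule nn_integral_add) measurable
  then show ?case by (simp add: Suc fun_eq_iff)
qed simp

lemma iterate_cmult:
  assumes [measurable]: "f \<in> borel_measurable borel"
  shows "(step_mean ^^ j) (\<lambda>t. c * f t) = (\<lambda>t. c * (step_mean ^^ j) f t)"
proof (induction j)
  case (Suc j)
  have "step_mean (\<lambda>t. c * (step_mean ^^ j) f t) u = c * step_mean ((step_mean ^^ j) f) u" for u
    unfolding step_mean_def[of _ u] by (rule nn_integral_cmult) measurable
  then show ?case by (simp add: Suc fun_eq_iff)
qed simp

lemma iterate_shift: "(step_mean ^^ j) (\<lambda>t. f (t + d)) = (\<lambda>t. (step_mean ^^ j) f (t + d))"
proof (induction j)
  case (Suc j)
  have "step_mean (\<lambda>t. (step_mean ^^ j) f (t + d)) u = step_mean ((step_mean ^^ j) f) (u + d)" for u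
    unfolding step_mean_def[of _ u] step_mean_def[of _ "u + d"] by (simp add: add_ac)
  then show ?case by (simp add: Suc fun_eq_iff)
qed simp

lemma integrable_bounded:
  fixes g :: "real \<Rightarrow> real"
  assumes "g \<in> borel_measurable borel" "\<And>x. 0 < x \<Longrightarrow> x < 1 \<Longrightarrow> \<bar>g x\<bar> \<le> B"
  shows "integrable \<omega> g"
  using assms by (intro integrable_const_bound[of _ B] AE_unit) auto

lemma integrable_id: "integrable \<omega> (\<lambda>x. x)"
  by (rule integrable_bounded[of _ 1]) auto

lemma mean_X_pos: "0 < mean_X" and mean_X_le: "mean_X \<le> 1"
proof -
  have "0 \<le> mean_X" unfolding mean_X_def by (intro integral_nonneg_AE AE_unit) auto
  moreover have "mean_X \<noteq> 0"
  proof
    assume "mean_X = 0"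
    then have "AE x in \<omega>. x = 0"
      unfolding mean_X_def by (subst (asm) integral_nonneg_eq_0_iff_AE[OF integrable_id]) (auto intro:
          AE_unit)
    with unit have "AE x in \<omega>. False" by eventually_elim auto
    then show False by simp
  qed
  ultimately show "0 < mean_X" by simp
  have "mean_X \<le> (\<integral>x. 1 \<partial>\<omega>)" unfolding mean_X_def using integrable_id by (intro integral_mono_AE AE_unit) auto
  then show "mean_X \<le> 1" by simp
qed

lemma nn_integral_id: "(\<integral>\<^sup>+x. ennreal (c * x) \<partial>\<omega>) = ennreal (c * mean_X)" if "0 \<le> c"
  using that integrable_id by (subst nn_integral_eq_integral) (auto simp: mean_X_def intro!: AE_unit)

lemma hit_prob_nn_le_exp: "hit_prob_nn t \<le> ennreal (exp t * mean_X)"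
proof -
  have "hit_prob_nn t \<le> (\<integral>\<^sup>+x. ennreal (exp t * x) \<partial>\<omega>)"
    unfolding hit_prob_nn_def
  proof (intro nn_integral_mono ennreal_leI)
    show "1 - exp (- (exp t * x)) \<le> exp t * x" for x
      using exp_ge_add_one_self[of "- (exp t * x)"] by linarith
  qed
  then show ?thesis by (simp add: nn_integral_id)
qed

lemma hit_prob_nn_le_1: "hit_prob_nn t \<le> 1"
proof -
  have "hit_prob_nn t \<le> (\<integral>\<^sup>+x. 1 \<partial>\<omega>)"
    unfolding hit_prob_nn_def by (intro nn_integral_mono) (auto simp flip: ennreal_1 intro!: ennreal_leI)
  then show ?thesis by simp
qed

lemma step_mean_exp:
  assumes "0 \<le> c"
  shows "step_mean (\<lambda>t. ennreal (exp t * c)) t = ennreal (exp t * (c * (1 - mean_X)))"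
proof -
  have "step_mean (\<lambda>t. ennreal (exp t * c)) t = (\<integral>\<^sup>+x. ennreal (exp t * c * (1 - x)) \<partial>\<omega>)"
    unfolding step_mean_def by (intro nn_integral_cong_AE AE_unit) (auto simp: exp_add mult_ac)
  also have "\<dots> = ennreal (\<integral>x. exp t * c * (1 - x) \<partial>\<omega>)"
    using assms integrable_id by (intro nn_integral_eq_integral AE_unit) auto
  also have "(\<integral>x. exp t * c * (1 - x) \<partial>\<omega>) = exp t * (c * (1 - mean_X))"
    using integrable_id by (simp add: mean_X_def)
  finally show ?thesis .
qed

lemma iterate_hit_prob_nn_le: "(step_mean ^^ j) hit_prob_nn t \<le> ennreal (exp t * (mean_X * (1 - mean_X) ^ j))"
proof (induction j arbitrary: t)
  case (Suc j)
  have "(step_mean ^^ Suc j) hit_prob_nn t \<le> step_mean (\<lambda>t. ennreal (exp t * (mean_X * (1 - mean_X) ^ j))) t"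
    unfolding funpow.simps comp_def step_mean_def[of _ t] by (intro nn_integral_mono Suc)
  also have "\<dots> = ennreal (exp t * (mean_X * (1 - mean_X) ^ Suc j))"
    using mean_X_pos mean_X_le by (subst step_mean_exp) (auto simp: mult_ac)
  finally show ?case .
qed (simp add: hit_prob_nn_le_exp)

text \<open>
  The \<open>j\<close>-th interval has mean length \<open>mean_X * (1 - mean_X) ^ j\<close>, and these lengths add up to \<open>1\<close>.
\<close>

lemma poisson_mean_nn_le_exp: "poisson_mean_nn t \<le> ennreal (exp t)"
proof -
  have "(\<lambda>j. (1 - mean_X) ^ j) sums (1 / (1 - (1 - mean_X)))"
    using mean_X_pos mean_X_le by (intro geometric_sums) auto
  then have "(\<lambda>j. exp t * (mean_X * (1 - mean_X) ^ j)) sums (exp t * (mean_X * (1 / (1 - (1 - mean_X)))))"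
    by (intro sums_mult)
  then have sums: "(\<lambda>j. exp t * (mean_X * (1 - mean_X) ^ j)) sums exp t" using mean_X_pos by simp
  have "poisson_mean_nn t \<le> (\<Sum>j. ennreal (exp t * (mean_X * (1 - mean_X) ^ j)))"
    unfolding poisson_mean_nn_def by (intro suminf_le iterate_hit_prob_nn_le) auto
  also have "\<dots> = ennreal (exp t)"
    using mean_X_pos mean_X_le sums by (intro suminf_ennreal_eq) auto
  finally show ?thesis .
qed

lemma poisson_mean_nn_renewal: "poisson_mean_nn t = hit_prob_nn t + step_mean poisson_mean_nn t"
proof -
  have "poisson_mean_nn t = (step_mean ^^ 0) hit_prob_nn t + (\<Sum>j. (step_mean ^^ Suc j) hit_prob_nn t)"
    unfolding poisson_mean_nn_def by (subst suminf_offset[of _ 1]) (auto simp: add.commute)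
  also have "(\<Sum>j. (step_mean ^^ Suc j) hit_prob_nn t) = step_mean poisson_mean_nn t"
    by (simp add: step_mean_def poisson_mean_nn_def nn_integral_suminf)
  finally show ?thesis by simp
qed

text \<open>
  A function bounded by the expected drop of \<open>hit_prob_nn\<close> in one step has a bounded sum along the walk.
  The drop is stated additively because subtraction of extended nonnegative reals truncates.
\<close>

lemma iterate_telescope:
  assumes [measurable]: "g \<in> borel_measurable borel" and g: "\<And>t. g t + step_mean hit_prob_nn t
      \<le> hit_prob_nn t"
  shows "(\<Sum>j. (step_mean ^^ j) g t) \<le> hit_prob_nn t"
proof -
  have "(\<Sum>j<N. (step_mean ^^ j) g t) + (step_mean ^^ N) hit_prob_nn t \<le> hit_prob_nn t" for N
  proof (induction N)
    case (Suc N)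
    have "(step_mean ^^ Suc N) hit_prob_nn t = (step_mean ^^ N) (step_mean hit_prob_nn) t"
        by (simp add: funpow_swap1)
    then have "(\<Sum>j<Suc N. (step_mean ^^ j) g t) + (step_mean ^^ Suc N) hit_prob_nn t
        = (\<Sum>j<N. (step_mean ^^ j) g t) + (step_mean ^^ N) (\<lambda>t. g t + step_mean hit_prob_nn t) t"
      by (simp add: iterate_add add.assoc del: funpow.simps)
    also have "\<dots> \<le> (\<Sum>j<N. (step_mean ^^ j) g t) + (step_mean ^^ N) hit_prob_nn t"
        by (intro add_left_mono iterate_mono g)
    finally show ?case using Suc by (rule order.trans)
  qed simp
  then have "(\<Sum>j<N. (step_mean ^^ j) g t) \<le> hit_prob_nn t" for N by (meson dual_order.trans le_iff_add)
  then show ?thesis by (intro suminf_le_const) auto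
qed

text \<open>
  The derivative of \<open>hit_prob_nn\<close>.
\<close>

definition hit_rate :: "real \<Rightarrow> ennreal" where
  "hit_rate t = (\<integral>\<^sup>+x. ennreal (exp t * x * exp (- (exp t * x))) \<partial>\<omega>)"

lemma hit_rate_measurable [measurable]: "hit_rate \<in> borel_measurable borel"
  unfolding hit_rate_def[abs_def] by measurable

text \<open>
  With \<open>y = exp t * x'\<close>, breaking off a fraction \<open>x\<close> lowers \<open>1 - exp (- y)\<close> by
  \<open>exp (- y) * (exp (y * x) - 1)\<close>, which is at least \<open>x * (y * exp (- y))\<close>; the two factors have
  independent randomness \<open>x\<close> and \<open>x'\<close>.
\<close>

lemma hit_rate_le_drop: "ennreal mean_X * hit_rate t + step_mean hit_prob_nn t \<le> hit_prob_nn t"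
proof -
  have pointwise: "ennreal x * ennreal (exp t * x' * exp (- (exp t * x')))
      + ennreal (1 - exp (- (exp (t + ln (1 - x)) * x'))) \<le> ennreal (1 - exp (- (exp t * x')))"
    if "0 < x" "x < 1" "0 < x'" for x x' :: real
  proof -
    define y where "y = exp t * x'"
    have y: "0 \<le> y" using that by (simp add: y_def)
    have "exp (- y) * (1 + y * x) \<le> exp (- y) * exp (y * x)" by (intro mult_left_mono) auto
    also have "\<dots> = exp (- (exp (t + ln (1 - x)) * x'))"
      unfolding mult_exp_exp using that by (intro arg_cong[of _ _ exp]) (simp add: y_def exp_add
          algebra_simps)
    finally have "x * (y * exp (- y)) + (1 - exp (- (exp (t + ln (1 - x)) * x'))) \<le> 1 - exp (- y)"
      by (simp add: algebra_simps)
    moreover have "0 \<le> 1 - exp (- (exp (t + ln (1 - x)) * x'))" using that by simp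
    ultimately show ?thesis using that y unfolding y_def[symmetric]
      by (simp add: ennreal_leI flip: ennreal_mult ennreal_plus)
  qed
  have "ennreal mean_X * hit_rate t = (\<integral>\<^sup>+x. ennreal x * hit_rate t \<partial>\<omega>)"
    using nn_integral_id[of 1] by (simp add: nn_integral_multc)
  then have "ennreal mean_X * hit_rate t + step_mean hit_prob_nn t
      = (\<integral>\<^sup>+x. ennreal x * hit_rate t + hit_prob_nn (t + ln (1 - x)) \<partial>\<omega>)"
    by (simp add: step_mean_def nn_integral_add)
  also have "\<dots> = (\<integral>\<^sup>+x. \<integral>\<^sup>+x'. ennreal x * ennreal (exp t * x' * exp (- (exp t * x')))
      + ennreal (1 - exp (- (exp (t + ln (1 - x)) * x'))) \<partial>\<omega> \<partial>\<omega>)"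
    by (simp add: hit_rate_def hit_prob_nn_def nn_integral_add nn_integral_cmult)
  also have "\<dots> \<le> (\<integral>\<^sup>+x. \<integral>\<^sup>+x'. ennreal (1 - exp (- (exp t * x'))) \<partial>\<omega> \<partial>\<omega>)"
    using unit
  proof (intro nn_integral_mono_AE, eventually_elim)
    case (elim x)
    show ?case using unit by (intro nn_integral_mono_AE, eventually_elim) (use elim pointwise in blast)
  qed
  also have "\<dots> = hit_prob_nn t" by (simp add: hit_prob_nn_def)
  finally show ?thesis .
qed

lemma hit_prob_nn_increment:
  assumes "0 \<le> d"
  shows "hit_prob_nn (t + d) \<le> hit_prob_nn t + ennreal (exp d - 1) * hit_rate t"
proof -
  have "hit_prob_nn (t + d) \<le> (\<integral>\<^sup>+x. ennreal (1 - exp (- (exp t * x)))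
      + ennreal (exp d - 1) * ennreal (exp t * x * exp (- (exp t * x))) \<partial>\<omega>)"
    unfolding hit_prob_nn_def using unit
  proof (intro nn_integral_mono_AE, eventually_elim)
    case (elim x)
    define y where "y = exp t * x"
    have y: "0 \<le> y" using elim by (simp add: y_def)
    have "exp (- y) * (1 - (exp d - 1) * y) \<le> exp (- y) * exp (- ((exp d - 1) * y))"
      using exp_ge_add_one_self[of "- ((exp d - 1) * y)"] by (intro mult_left_mono) auto
    also have "\<dots> = exp (- (exp (t + d) * x))"
      unfolding mult_exp_exp by (intro arg_cong[of _ _ exp]) (simp add: y_def exp_add algebra_simps)
    finally have "1 - exp (- (exp (t + d) * x)) \<le> (1 - exp (- y)) + (exp d - 1) * (y * exp (- y))"
      by (simp add: algebra_simps)
    then show ?case using y assms unfolding y_def[symmetric]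
      by (simp add: ennreal_leI flip: ennreal_mult ennreal_plus)
  qed
  also have "\<dots> = hit_prob_nn t + ennreal (exp d - 1) * hit_rate t"
    by (simp add: hit_prob_nn_def hit_rate_def nn_integral_add nn_integral_cmult)
  finally show ?thesis .
qed

lemma hit_prob_nn_mono: "t \<le> s \<Longrightarrow> hit_prob_nn t \<le> hit_prob_nn s"
  unfolding hit_prob_nn_def by (intro nn_integral_mono_AE AE_unit) (auto intro!: ennreal_leI)

lemma poisson_mean_nn_mono: "t \<le> s \<Longrightarrow> poisson_mean_nn t \<le> poisson_mean_nn s"
proof -
  assume "t \<le> s"
  have "(step_mean ^^ j) hit_prob_nn t \<le> (step_mean ^^ j) hit_prob_nn (t + (s - t))" for j
    using iterate_mono[of hit_prob_nn "\<lambda>u. hit_prob_nn (u + (s - t))" j t] hit_prob_nn_mono \<open>t \<le> s\<close>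
        by (simp add: iterate_shift)
  then show ?thesis unfolding poisson_mean_nn_def using \<open>t \<le> s\<close> by (intro suminf_le) auto
qed

text \<open>
  An increment of \<open>hit_prob_nn\<close> is at most \<open>exp d - 1\<close> times \<open>hit_rate\<close>, and \<open>mean_X * hit_rate\<close> is at most
  the drop of \<open>hit_prob_nn\<close> in one step, whose sum along the walk telescopes.
\<close>

lemma poisson_mean_nn_increment:
  assumes "0 \<le> d"
  shows "ennreal mean_X * poisson_mean_nn (t + d) \<le> ennreal mean_X * poisson_mean_nn t + ennreal (exp d - 1)"
proof -
  let ?c = "ennreal (exp d - 1)"
  have "ennreal mean_X * poisson_mean_nn (t + d)
      = ennreal mean_X * (\<Sum>j. (step_mean ^^ j) (\<lambda>t. hit_prob_nn (t + d)) t)"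
    by (simp add: poisson_mean_nn_def iterate_shift)
  also have "\<dots> \<le> ennreal mean_X * (\<Sum>j. (step_mean ^^ j) (\<lambda>t. hit_prob_nn t + ?c * hit_rate t) t)"
    using hit_prob_nn_increment[OF assms] by (intro mult_left_mono suminf_le iterate_mono) auto
  also have "\<dots> = ennreal mean_X * (poisson_mean_nn t + ?c * (\<Sum>j. (step_mean ^^ j) hit_rate t))"
    by (simp add: iterate_add iterate_cmult poisson_mean_nn_def flip: suminf_add)
  also have "\<dots> = ennreal mean_X * poisson_mean_nn t
      + ?c * (\<Sum>j. (step_mean ^^ j) (\<lambda>t. ennreal mean_X * hit_rate t) t)"
    by (simp add: iterate_cmult distrib_left mult_ac)
  also have "\<dots> \<le> ennreal mean_X * poisson_mean_nn t + ?c * 1"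
  proof (intro add_left_mono mult_left_mono)
    have "(\<Sum>j. (step_mean ^^ j) (\<lambda>t. ennreal mean_X * hit_rate t) t) \<le> hit_prob_nn t"
      by (rule iterate_telescope) (auto simp: hit_rate_le_drop)
    then show "(\<Sum>j. (step_mean ^^ j) (\<lambda>t. ennreal mean_X * hit_rate t) t) \<le> 1" using hit_prob_nn_le_1
        by (rule order.trans)
  qed simp
  finally show ?thesis by simp
qed

definition poisson_mean :: "real \<Rightarrow> real" where "poisson_mean t = enn2real (poisson_mean_nn t)"

lemma poisson_mean_nn_eq: "poisson_mean_nn t = ennreal (poisson_mean t)"
proof -
  have "poisson_mean_nn t < \<top>" using poisson_mean_nn_le_exp by (rule le_less_trans) simp
  then show ?thesis by (simp add: poisson_mean_def)
qed

lemma poisson_mean_nonneg: "0 \<le> poisson_mean t" by (simp add: poisson_mean_def)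

lemma poisson_mean_mono: "t \<le> s \<Longrightarrow> poisson_mean t \<le> poisson_mean s" using poisson_mean_nn_mono[of t s]
    by (simp add: poisson_mean_nn_eq poisson_mean_nonneg)

lemma poisson_mean_measurable [measurable]: "poisson_mean \<in> borel_measurable borel"
  by (intro borel_measurable_mono monoI poisson_mean_mono)

lemma poisson_mean_increment:
  assumes "0 \<le> d"
  shows "poisson_mean (t + d) \<le> poisson_mean t + (exp d - 1) / mean_X"
proof -
  have "ennreal (mean_X * poisson_mean (t + d)) \<le> ennreal (mean_X * poisson_mean t + (exp d - 1))"
    using poisson_mean_nn_increment[OF assms, of t] mean_X_pos poisson_mean_nonneg assms
        by (simp add: poisson_mean_nn_eq ennreal_mult)
  then have "mean_X * poisson_mean (t + d) \<le> mean_X * poisson_mean t + (exp d - 1)"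
    using mean_X_pos poisson_mean_nonneg[of t] assms by (subst (asm) ennreal_le_iff) auto
  then show ?thesis using mean_X_pos by (simp add: field_simps)
qed

text \<open>
  The exponential increment bound is linear for short steps, so cutting \<open>s - t\<close> into \<open>n\<close> pieces and
  letting \<open>n\<close> grow gives the sharp linear bound.
\<close>

lemma poisson_mean_growth:
  assumes "t \<le> s"
  shows "poisson_mean s - poisson_mean t \<le> (s - t) / mean_X"
proof -
  define d where "d = s - t"
  have d: "0 \<le> d" using assms by (simp add: d_def)
  have step: "poisson_mean (t + d) - poisson_mean t
      \<le> real n * (exp (d / real n) - 1) / mean_X" if "0 < n" for n
  proof -
    have "poisson_mean (t + real k * (d / real n))
        \<le> poisson_mean t + real k * (exp (d / real n) - 1) / mean_X" for k
    proof (induction k)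
      case (Suc k)
      have "poisson_mean (t + real (Suc k) * (d / real n))
          = poisson_mean ((t + real k * (d / real n)) + d / real n)"
        by (simp add: distrib_right add_divide_distrib add_ac)
      also have "\<dots> \<le> poisson_mean (t + real k * (d / real n)) + (exp (d / real n) - 1) / mean_X"
        using d by (intro poisson_mean_increment) simp
      also have "\<dots> \<le> poisson_mean t + real k * (exp (d / real n) - 1) / mean_X
          + (exp (d / real n) - 1) / mean_X"
        using Suc by simp
      also have "\<dots> = poisson_mean t + real (Suc k) * (exp (d / real n) - 1) / mean_X"
        by (simp add: add_divide_distrib distrib_right)
      finally show ?case .
    qed simp
    from this[of n] that show ?thesis by simp
  qed
  have "(\<lambda>n. real n * (exp (d / real n) - 1) / mean_X) \<longlonglongrightarrow> d * inverse mean_X"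
    using mean_X_pos by real_asymp
  moreover have "\<forall>\<^sub>F n in sequentially. poisson_mean (t + d) - poisson_mean t
      \<le> real n * (exp (d / real n) - 1) / mean_X"
    using eventually_gt_at_top[of 0] by eventually_elim (rule step)
  ultimately show ?thesis by (auto simp: d_def divide_inverse dest: tendsto_lowerbound)
qed

lemma poisson_mean_lipschitz: "\<bar>poisson_mean t - poisson_mean s\<bar> \<le> 1 / mean_X * \<bar>t - s\<bar>"
  using poisson_mean_growth[of t s] poisson_mean_growth[of s t] poisson_mean_mono[of t s]
      poisson_mean_mono[of s t] by (cases "t \<le> s") auto

definition hit_prob :: "real \<Rightarrow> real" where
  "hit_prob t = (\<integral>x. 1 - exp (- (exp t * x)) \<partial>\<omega>)"

lemma abs_one_minus_exp: "0 \<le> y \<Longrightarrow> \<bar>1 - exp (- y)\<bar> \<le> (1 :: real)"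
  by simp

lemma hit_prob_integrable: "integrable \<omega> (\<lambda>x. 1 - exp (- (exp t * x)))"
  by (rule integrable_bounded[of _ 1]) (auto simp: abs_one_minus_exp)

lemma hit_prob_tendsto_1: "(hit_prob \<longlongrightarrow> 1) at_top"
proof -
  have "((\<lambda>t. \<integral>x. 1 - exp (- (exp t * x)) \<partial>\<omega>) \<longlongrightarrow> (\<integral>x. 1 \<partial>\<omega>)) at_top"
  proof (rule integral_dominated_convergence_at_top[where w="\<lambda>_. 1"])
    show "AE x in \<omega>. ((\<lambda>t. 1 - exp (- (exp t * x))) \<longlongrightarrow> 1) at_top"
      by (rule AE_unit) real_asymp
    show "\<forall>\<^sub>F t in at_top. AE x in \<omega>. norm (1 - exp (- (exp t * x))) \<le> 1"
      by (intro always_eventually allI AE_unit) (auto simp: abs_one_minus_exp)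
  qed auto
  then show ?thesis by (simp add: hit_prob_def[abs_def])
qed

lemma poisson_mean_shift_integrable: "integrable \<omega> (\<lambda>x. poisson_mean (t + ln (1 - x)))"
proof (rule integrable_bounded[of _ "poisson_mean t"])
  fix x :: real assume "0 < x" "x < 1"
  then have "t + ln (1 - x) \<le> t" by simp
  then show "\<bar>poisson_mean (t + ln (1 - x))\<bar> \<le> poisson_mean t" using poisson_mean_mono poisson_mean_nonneg
      by simp
qed simp

lemma poisson_mean_renewal: "poisson_mean t = hit_prob t + (\<integral>x. poisson_mean (t + ln (1 - x)) \<partial>\<omega>)"
proof -
  have "hit_prob_nn t = ennreal (hit_prob t)" unfolding hit_prob_nn_def hit_prob_def
    by (intro nn_integral_eq_integral hit_prob_integrable AE_unit) auto
  moreover have "step_mean poisson_mean_nn t = ennreal (\<integral>x. poisson_mean (t + ln (1 - x)) \<partial>\<omega>)"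
    unfolding step_mean_def poisson_mean_nn_eq
        by (intro nn_integral_eq_integral poisson_mean_shift_integrable AE_I2 poisson_mean_nonneg)
  moreover have "0 \<le> hit_prob t" unfolding hit_prob_def by (intro integral_nonneg_AE AE_unit) auto
  moreover have "0 \<le> (\<integral>x. poisson_mean (t + ln (1 - x)) \<partial>\<omega>)"
      by (intro integral_nonneg_AE AE_I2 poisson_mean_nonneg)
  ultimately show ?thesis using poisson_mean_nn_renewal[of t]
      by (simp add: poisson_mean_nn_eq poisson_mean_nonneg flip: ennreal_plus)
qed

text \<open>
  For fixed \<open>x\<close> the factor \<open>x\<close> inside \<open>exp s * x\<close> is a translation of \<open>s\<close> by \<open>ln x\<close>.
\<close>

lemma nn_integral_hit_prob_nn_atMost:
  "(\<integral>\<^sup>+s. hit_prob_nn s * indicator {..t} s \<partial>lborel) = (\<integral>\<^sup>+x. ennreal (Phi (t + ln x)) \<partial>\<omega>)"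
proof -
  have "(\<integral>\<^sup>+s. hit_prob_nn s * indicator {..t} s \<partial>lborel) =
     (\<integral>\<^sup>+s. \<integral>\<^sup>+x. ennreal (1 - exp (- (exp s * x))) * indicator {..t} s \<partial>\<omega> \<partial>lborel)"
    by (simp add: hit_prob_nn_def nn_integral_multc)
  also have "\<dots> = (\<integral>\<^sup>+x. \<integral>\<^sup>+s. ennreal (1 - exp (- (exp s * x))) * indicator {..t} s \<partial>lborel \<partial>\<omega>)"
    by (rule pair_sigma_finite.Fubini'[symmetric]) (unfold_locales, measurable)
  also have "\<dots> = (\<integral>\<^sup>+x. ennreal (Phi (t + ln x)) \<partial>\<omega>)"
  proof (intro nn_integral_cong_AE AE_unit)
    fix x :: real assume x: "0 < x" "x < 1"
    have "(\<integral>\<^sup>+s. ennreal (1 - exp (- (exp s * x))) * indicator {..t} s \<partial>lborel) =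
      (\<integral>\<^sup>+s. ennreal (1 - exp (- (exp (- ln x + 1 * s) * x))) * indicator {..t} (- ln x + 1 * s) \<partial>lborel)"
      by (subst nn_integral_real_affine[where c=1 and t="- ln x"]) auto
    also have "\<dots> = (\<integral>\<^sup>+s. ennreal (1 - exp (- exp s)) * indicator {..t + ln x} s \<partial>lborel)"
      using x by (intro nn_integral_cong) (auto simp: indicator_def exp_diff)
    finally show "(\<integral>\<^sup>+s. ennreal (1 - exp (- (exp s * x))) * indicator {..t} s \<partial>lborel)
        = ennreal (Phi (t + ln x))"
      by (simp add: Phi_nn)
  qed
  finally show ?thesis .
qed

lemma past_integral_measurable [measurable]:
  "(\<lambda>x. \<integral>\<^sup>+s. ennreal (poisson_mean (t - s)) * indicator {0..<- ln (1 - x)} s \<partial>lborel) \<in> borel_measurable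
      borel"
proof -
  have "(\<lambda>x. \<integral>\<^sup>+s. ennreal (poisson_mean (t - s)) * indicator {0..<- ln (1 - x)} s \<partial>lborel) =
    (\<lambda>x. \<integral>\<^sup>+s. (if 0 \<le> s \<and> s < - ln (1 - x) then ennreal (poisson_mean (t - s)) else 0) \<partial>lborel)"
    by (intro ext nn_integral_cong) (auto simp: indicator_def)
  also have "\<dots> \<in> borel_measurable borel" by measurable
  finally show ?thesis .
qed

text \<open>
  Let \<open>I t\<close> be the integral of \<open>poisson_mean\<close> over \<open>{..t}\<close>. The renewal equation integrates to
  \<open>I t = H t + E (I (t + ln (1 - X)))\<close>, whereas splitting the domain at \<open>t + ln (1 - X)\<close> gives
  \<open>I t = E (I (t + ln (1 - X))) + E (\<integral>s\<in>{0..- ln (1 - X)}. poisson_mean (t - s))\<close>. The common term is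
  finite because \<open>poisson_mean\<close> decays exponentially at minus infinity, and cancels.
\<close>

lemma integrated_renewal:
  "(\<integral>\<^sup>+x. \<integral>\<^sup>+s. ennreal (poisson_mean (t - s)) * indicator {0..<- ln (1 - x)} s \<partial>lborel \<partial>\<omega>)
    = (\<integral>\<^sup>+x. ennreal (Phi (t + ln x)) \<partial>\<omega>)"
proof -
  define I where "I t = (\<integral>\<^sup>+s. poisson_mean_nn s * indicator {..t} s \<partial>lborel)" for t
  have I_fin: "I t < \<top>" for t
  proof -
    have "I t \<le> (\<integral>\<^sup>+s. ennreal (exp s) * indicator {..t} s \<partial>lborel)"
      unfolding I_def by (intro nn_integral_mono mult_right_mono poisson_mean_nn_le_exp) simp
    also have "\<dots> < \<top>" by (simp add: nn_integral_exp_atMost)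
    finally show ?thesis .
  qed
  have I_mono: "I s \<le> I t" if "s \<le> t" for s t
    unfolding I_def using that by (intro nn_integral_mono) (auto simp: indicator_def)
  have I_meas [measurable]: "I \<in> borel_measurable borel"
  proof -
    have "I = (\<lambda>t. \<integral>\<^sup>+s. (if s \<le> t then poisson_mean_nn s else 0) \<partial>lborel)"
      unfolding I_def by (intro ext nn_integral_cong) (auto simp: indicator_def)
    also have "\<dots> \<in> borel_measurable borel" by measurable
    finally show ?thesis .
  qed
  have I_shift: "I (t + ln (1 - x)) = (\<integral>\<^sup>+s. poisson_mean_nn (s
      + ln (1 - x)) * indicator {..t} s \<partial>lborel)" for x
    unfolding I_def by (subst nn_integral_real_affine[where c=1 and t="ln (1 - x)"])
      (auto simp: indicator_def add_ac intro!: nn_integral_cong)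
  have "I t = (\<integral>\<^sup>+s. hit_prob_nn s * indicator {..t} s
      + step_mean poisson_mean_nn s * indicator {..t} s \<partial>lborel)"
    unfolding I_def by (subst poisson_mean_nn_renewal) (simp add: distrib_right)
  also have "\<dots> = (\<integral>\<^sup>+s. hit_prob_nn s * indicator {..t} s \<partial>lborel)
      + (\<integral>\<^sup>+s. step_mean poisson_mean_nn s * indicator {..t} s \<partial>lborel)"
    by (rule nn_integral_add) measurable
  also have "(\<integral>\<^sup>+s. step_mean poisson_mean_nn s * indicator {..t} s \<partial>lborel) =
    (\<integral>\<^sup>+s. \<integral>\<^sup>+x. poisson_mean_nn (s + ln (1 - x)) * indicator {..t} s \<partial>\<omega> \<partial>lborel)"
    unfolding step_mean_def by (simp add: nn_integral_multc)
  also have "\<dots> = (\<integral>\<^sup>+x. \<integral>\<^sup>+s. poisson_mean_nn (s + ln (1 - x)) * indicator {..t} s \<partial>lborel \<partial>\<omega>)"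
    by (rule pair_sigma_finite.Fubini'[symmetric]) (unfold_locales, measurable)
  also have "\<dots> = (\<integral>\<^sup>+x. I (t + ln (1 - x)) \<partial>\<omega>)" by (simp add: I_shift)
  finally have eq1: "I t = (\<integral>\<^sup>+s. hit_prob_nn s * indicator {..t} s \<partial>lborel) + (\<integral>\<^sup>+x. I (t
      + ln (1 - x)) \<partial>\<omega>)" .
  have split: "I t = I (t + ln (1 - x))
      + (\<integral>\<^sup>+s. ennreal (poisson_mean (t - s)) * indicator {0..<- ln (1 - x)} s \<partial>lborel)"
    if x: "0 < x" "x < 1" for x
  proof -
    have neg: "ln (1 - x) < 0" using x by simp
    have "I t = (\<integral>\<^sup>+s. poisson_mean_nn s * indicator {..t + ln (1 - x)} s
        + poisson_mean_nn s * indicator {t + ln (1 - x)<..t} s \<partial>lborel)"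
      unfolding I_def using neg by (intro nn_integral_cong) (auto simp: indicator_def)
    also have "\<dots> = I (t + ln (1 - x)) + (\<integral>\<^sup>+s. poisson_mean_nn s * indicator {t + ln (1 - x)<..t} s \<partial>lborel)"
      unfolding I_def by (rule nn_integral_add) measurable
    also have "(\<integral>\<^sup>+s. poisson_mean_nn s * indicator {t + ln (1 - x)<..t} s \<partial>lborel) =
       (\<integral>\<^sup>+s. ennreal (poisson_mean (t - s)) * indicator {0..<- ln (1 - x)} s \<partial>lborel)"
      by (subst nn_integral_real_affine[where c="-1" and t=t])
        (auto simp: indicator_def poisson_mean_nn_eq intro!: nn_integral_cong)
    finally show ?thesis .
  qed
  have "I t = (\<integral>\<^sup>+x. I t \<partial>\<omega>)" by simp
  also have "\<dots> = (\<integral>\<^sup>+x. I (t + ln (1 - x))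
      + (\<integral>\<^sup>+s. ennreal (poisson_mean (t - s)) * indicator {0..<- ln (1 - x)} s \<partial>lborel) \<partial>\<omega>)"
    by (intro nn_integral_cong_AE AE_unit split)
  also have "\<dots> = (\<integral>\<^sup>+x. I (t + ln (1 - x)) \<partial>\<omega>)
    + (\<integral>\<^sup>+x. \<integral>\<^sup>+s. ennreal (poisson_mean (t - s)) * indicator {0..<- ln (1 - x)} s \<partial>lborel \<partial>\<omega>)"
    by (rule nn_integral_add) measurable
  finally have eq2: "I t = (\<integral>\<^sup>+x. I (t + ln (1 - x)) \<partial>\<omega>)
    + (\<integral>\<^sup>+x. \<integral>\<^sup>+s. ennreal (poisson_mean (t - s)) * indicator {0..<- ln (1 - x)} s \<partial>lborel \<partial>\<omega>)" .
  have "(\<integral>\<^sup>+x. I (t + ln (1 - x)) \<partial>\<omega>) \<le> (\<integral>\<^sup>+x. I t \<partial>\<omega>)"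
    by (intro nn_integral_mono_AE AE_unit I_mono) simp
  then have "(\<integral>\<^sup>+x. I (t + ln (1 - x)) \<partial>\<omega>) \<noteq> \<top>" using I_fin[of t] by (auto simp: top_unique)
  moreover have "(\<integral>\<^sup>+x. I (t + ln (1 - x)) \<partial>\<omega>) + (\<integral>\<^sup>+x. ennreal (Phi (t + ln x)) \<partial>\<omega>) =
    (\<integral>\<^sup>+x. I (t + ln (1 - x)) \<partial>\<omega>)
    + (\<integral>\<^sup>+x. \<integral>\<^sup>+s. ennreal (poisson_mean (t - s)) * indicator {0..<- ln (1 - x)} s \<partial>lborel \<partial>\<omega>)"
    using eq1 eq2 unfolding nn_integral_hit_prob_nn_atMost by (simp only: add.commute)
  ultimately show ?thesis by (simp only: ennreal_add_left_cancel) simp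
qed

end

section \<open>Blackwell's theorem and the second-order expansion\<close>

text \<open>
  A law carried by no geometric sequence is one whose steps \<open>- ln (1 - X)\<close> are not confined to the
  multiples of some \<open>c > 0\<close>.
\<close>

locale stick_law_moments = stick_law +
  assumes nonlattice: "\<not> (\<exists>x\<in>{0<..<1}. measure \<omega> {1 - x ^ j | j::nat. 1 \<le> j} = 1)"
    and ln_integrable: "integrable \<omega> (\<lambda>x. \<bar>ln x\<bar>)"
    and square_integrable: "integrable \<omega> (\<lambda>x. (ln (1 - x))\<^sup>2)"
begin

definition \<mu> :: real where "\<mu> = (\<integral>x. \<bar>ln (1 - x)\<bar> \<partial>\<omega>)"
definition \<nu> :: real where "\<nu> = (\<integral>x. (ln (1 - x))\<^sup>2 \<partial>\<omega>)"

lemma step_integrable: "integrable \<omega> (\<lambda>x. \<bar>ln (1 - x)\<bar>)"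
proof (rule Bochner_Integration.integrable_bound[of _ "\<lambda>x. 1 + (ln (1 - x))\<^sup>2"])
  show "AE x in \<omega>. norm \<bar>ln (1 - x)\<bar> \<le> norm (1 + (ln (1 - x))\<^sup>2)"
  proof (rule AE_I2)
    fix x :: real
    have "0 \<le> (\<bar>ln (1 - x)\<bar> - 1)\<^sup>2" by simp
    then have "2 * \<bar>ln (1 - x)\<bar> \<le> 1 + (ln (1 - x))\<^sup>2" by (simp add: power2_diff)
    then show "norm \<bar>ln (1 - x)\<bar> \<le> norm (1 + (ln (1 - x))\<^sup>2)" by simp
  qed
qed (use square_integrable in auto)

lemma \<mu>_pos: "0 < \<mu>"
proof -
  have "0 \<le> \<mu>" unfolding \<mu>_def by simp
  moreover have "\<mu> \<noteq> 0"
  proof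
    assume "\<mu> = 0"
    then have "AE x in \<omega>. \<bar>ln (1 - x)\<bar> = 0"
      unfolding \<mu>_def by (subst (asm) integral_nonneg_eq_0_iff_AE[OF step_integrable]) auto
    with unit have "AE x in \<omega>. False" by eventually_elim auto
    then show False by simp
  qed
  ultimately show ?thesis by simp
qed

text \<open>
  How much the integral of \<open>poisson_mean\<close> over a window of length \<open>y\<close> ending at \<open>t\<close> falls short of
  \<open>y * poisson_mean t\<close>.
\<close>

definition lag_deficit :: "real \<Rightarrow> real \<Rightarrow> real" where
  "lag_deficit t y = (\<integral>s. (poisson_mean t - poisson_mean (t - s)) * indicator {0..<y} s \<partial>lborel)"

lemma lag_deficit_bound: "\<bar>(poisson_mean t - poisson_mean (t - s)) * indicator {0..<y} s\<bar>
    \<le> y / mean_X * indicator {0..<y} s"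
proof (cases "s \<in> {0..<y}")
  case True
  then have "\<bar>poisson_mean t - poisson_mean (t - s)\<bar> \<le> 1 / mean_X * \<bar>s\<bar>"
      using poisson_mean_lipschitz[of t "t - s"] by simp
  also have "\<dots> \<le> 1 / mean_X * y" using True mean_X_pos by (intro mult_left_mono) auto
  finally show ?thesis using True by simp
qed simp

lemma indicator_integrable:
  fixes c y :: real
  shows "integrable lborel (\<lambda>s. c * indicator {0..<y} s)"
proof (intro integrable_mult_right integrable_real_indicator)
  show "emeasure lborel {0..<y} < \<infinity>" by (cases "0 \<le> y") auto
qed simp

lemma lag_deficit_integrable_inner: "integrable lborel (\<lambda>s. (poisson_mean t - poisson_mean (t - s)) *
    indicator {0..<y} s)"
proof (rule Bochner_Integration.integrable_bound[OF indicator_integrable[of "y / mean_X" y]])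
  show "AE s in lborel. norm ((poisson_mean t - poisson_mean (t - s)) * indicator {0..<y} s)
      \<le> norm (y / mean_X * indicator {0..<y} s)"
    using lag_deficit_bound by (intro AE_I2) (metis abs_ge_self order.trans real_norm_def)
qed measurable

lemma lag_deficit_nonneg: "0 \<le> lag_deficit t y"
  unfolding lag_deficit_def by (intro integral_nonneg_AE AE_I2) (auto simp: indicator_def poisson_mean_mono)

lemma lag_deficit_le:
  assumes "0 \<le> y"
  shows "lag_deficit t y \<le> y\<^sup>2 / mean_X"
proof -
  have "lag_deficit t y \<le> (\<integral>s. y / mean_X * indicator {0..<y} s \<partial>lborel)"
    unfolding lag_deficit_def using lag_deficit_bound[of t _ y]
    by (intro integral_mono lag_deficit_integrable_inner indicator_integrable) (auto simp: abs_le_iff)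
  also have "\<dots> = y\<^sup>2 / mean_X" using assms by (simp add: power2_eq_square)
  finally show ?thesis .
qed

lemma lag_deficit_measurable [measurable]: "lag_deficit t \<in> borel_measurable borel"
proof -
  have "lag_deficit t = (\<lambda>y. \<integral>s. (if 0
      \<le> s \<and> s < y then poisson_mean t - poisson_mean (t - s) else 0) \<partial>lborel)"
    unfolding lag_deficit_def by (intro ext Bochner_Integration.integral_cong) (auto simp: indicator_def)
  also have "\<dots> \<in> borel_measurable borel" by measurable
  finally show ?thesis .
qed

lemma lag_deficit_bound_step:
  assumes "0 < x" "x < 1"
  shows "\<bar>lag_deficit t (- ln (1 - x))\<bar> \<le> (ln (1 - x))\<^sup>2 / mean_X"
  using lag_deficit_le[of "- ln (1 - x)" t] lag_deficit_nonneg[of t "- ln (1 - x)"] assms by simp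

lemma lag_deficit_integrable: "integrable \<omega> (\<lambda>x. lag_deficit t (- ln (1 - x)))"
proof (rule Bochner_Integration.integrable_bound[of _ "\<lambda>x. (ln (1 - x))\<^sup>2 / mean_X"])
  show "AE x in \<omega>. norm (lag_deficit t (- ln (1 - x))) \<le> norm ((ln (1 - x))\<^sup>2 / mean_X)"
    using lag_deficit_bound_step mean_X_pos by (intro AE_unit) simp
qed (use square_integrable in auto)

lemma Phi_integrable: "integrable \<omega> (\<lambda>x. Phi (t + ln x))"
proof (rule integrable_bounded[of _ "1 + \<bar>t\<bar>"])
  fix x :: real assume "0 < x" "x < 1"
  then have "max 0 (t + ln x) \<le> \<bar>t\<bar>" using ln_less_zero[of x] by linarith
  then show "\<bar>Phi (t + ln x)\<bar> \<le> 1 + \<bar>t\<bar>" using Phi_le[of "t + ln x"] Phi_nonneg[of "t + ln x"] by simp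
qed measurable

definition integrated_hit_prob :: "real \<Rightarrow> real" where "integrated_hit_prob t = (\<integral>x. Phi (t + ln x) \<partial>\<omega>)"

text \<open>
  The integrated renewal equation, with the mean of \<open>poisson_mean\<close> over the last step expressed by its
  value at \<open>t\<close> and the deficit.
\<close>

lemma lag_deficit_identity: "\<mu> * poisson_mean t
    = integrated_hit_prob t + (\<integral>x. lag_deficit t (- ln (1 - x)) \<partial>\<omega>)"
proof -
  let ?c = "\<lambda>x. \<integral>\<^sup>+s. ennreal (poisson_mean (t - s)) * indicator {0..<- ln (1 - x)} s \<partial>lborel"
  have pointwise: "?c x + ennreal (lag_deficit t (- ln (1 - x)))
      = ennreal (poisson_mean t * \<bar>ln (1 - x)\<bar>)" if x: "0 < x" "x < 1" for x
  proof -
    define y where "y = - ln (1 - x)"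
    have y: "0 < y" using x by (simp add: y_def)
    have "ennreal (lag_deficit t y) = (\<integral>\<^sup>+s. ennreal ((poisson_mean t - poisson_mean (t - s)) * indicator
        {0..<y} s) \<partial>lborel)"
      unfolding lag_deficit_def
      by (intro nn_integral_eq_integral[symmetric] lag_deficit_integrable_inner AE_I2) (auto
          simp: indicator_def poisson_mean_mono)
    then have "(\<integral>\<^sup>+s. ennreal (poisson_mean (t - s)) * indicator {0..<y} s \<partial>lborel)
        + ennreal (lag_deficit t y) =
      (\<integral>\<^sup>+s. ennreal (poisson_mean (t - s)) * indicator {0..<y} s
          + ennreal ((poisson_mean t - poisson_mean (t - s)) * indicator {0..<y} s) \<partial>lborel)"
      by (subst nn_integral_add) auto
    also have "\<dots> = (\<integral>\<^sup>+s. ennreal (poisson_mean t) * indicator {0..<y} s \<partial>lborel)"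
      by (intro nn_integral_cong) (auto simp: indicator_def poisson_mean_nonneg poisson_mean_mono simp
          flip: ennreal_plus)
    also have "\<dots> = ennreal (poisson_mean t) * ennreal y" using y by (simp add: nn_integral_cmult)
    also have "\<dots> = ennreal (poisson_mean t * y)" using y poisson_mean_nonneg by (simp add: ennreal_mult)
    finally show ?thesis using y by (simp add: y_def)
  qed
  have "ennreal (integrated_hit_prob t) + ennreal (\<integral>x. lag_deficit t (- ln (1 - x)) \<partial>\<omega>) =
    (\<integral>\<^sup>+x. ennreal (Phi (t + ln x)) \<partial>\<omega>) + (\<integral>\<^sup>+x. ennreal (lag_deficit t (- ln (1 - x))) \<partial>\<omega>)"
    unfolding integrated_hit_prob_def
    by (subst (1 2) nn_integral_eq_integral) (auto intro!: Phi_integrable lag_deficit_integrable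
        simp: Phi_nonneg lag_deficit_nonneg)
  also have "(\<integral>\<^sup>+x. ennreal (Phi (t + ln x)) \<partial>\<omega>) = (\<integral>\<^sup>+x. ?c x \<partial>\<omega>)"
    by (rule integrated_renewal[symmetric])
  also have "(\<integral>\<^sup>+x. ?c x \<partial>\<omega>) + (\<integral>\<^sup>+x. ennreal (lag_deficit t (- ln (1 - x))) \<partial>\<omega>) =
    (\<integral>\<^sup>+x. ?c x + ennreal (lag_deficit t (- ln (1 - x))) \<partial>\<omega>)"
    by (rule nn_integral_add[symmetric]) measurable
  also have "\<dots> = (\<integral>\<^sup>+x. ennreal (poisson_mean t * \<bar>ln (1 - x)\<bar>) \<partial>\<omega>)"
    by (intro nn_integral_cong_AE AE_unit pointwise)
  also have "\<dots> = ennreal (poisson_mean t * \<mu>)"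
    unfolding \<mu>_def using step_integrable poisson_mean_nonneg
    by (subst nn_integral_eq_integral) auto
  finally have "ennreal (integrated_hit_prob t + (\<integral>x. lag_deficit t (- ln (1 - x)) \<partial>\<omega>))
      = ennreal (poisson_mean t * \<mu>)"
    by (subst ennreal_plus) (auto simp: integrated_hit_prob_def Phi_nonneg lag_deficit_nonneg)
  then show ?thesis
    by (subst (asm) ennreal_inj)
      (auto simp: integrated_hit_prob_def Phi_nonneg lag_deficit_nonneg poisson_mean_nonneg \<mu>_pos
          less_imp_le mult.commute intro!: add_nonneg_nonneg)
qed

text \<open>
  Dominated convergence: \<open>Phi (t + ln x) - t\<close> tends to \<open>\<gamma> + ln x\<close>, and for \<open>t \<ge> 0\<close> it is at most a
  constant plus a multiple of \<open>\<bar>ln x\<bar>\<close>.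
\<close>

lemma integrated_hit_prob_asymp: "((\<lambda>t. integrated_hit_prob t - t) \<longlongrightarrow> euler_mascheroni + (\<integral>x. ln x \<partial>\<omega>)) at_top"
proof -
  have ln_int: "integrable \<omega> (\<lambda>x. ln x)" using ln_integrable by (simp add: integrable_abs_iff)
  let ?g = "euler_mascheroni :: real"
  have "((\<lambda>t. \<integral>x. Phi (t + ln x) - t \<partial>\<omega>) \<longlongrightarrow> (\<integral>x. ?g + ln x \<partial>\<omega>)) at_top"
  proof (rule integral_dominated_convergence_at_top[where w="\<lambda>x. 1 + \<bar>?g\<bar> + 2 * \<bar>ln x\<bar>"])
    show "AE x in \<omega>. ((\<lambda>t. Phi (t + ln x) - t) \<longlongrightarrow> ?g + ln x) at_top"
    proof (rule AE_I2)
      fix x :: real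
      have "filterlim (\<lambda>t. t + ln x) at_top at_top" by real_asymp
      from filterlim_compose[OF Phi_asymp this]
      have "((\<lambda>t. Phi (t + ln x) - (t + ln x) + ln x) \<longlongrightarrow> ?g + ln x) at_top"
        by (intro tendsto_add tendsto_const)
      then show "((\<lambda>t. Phi (t + ln x) - t) \<longlongrightarrow> ?g + ln x) at_top" by (simp add: algebra_simps)
    qed
    show "\<forall>\<^sub>F t in at_top. AE x in \<omega>. norm (Phi (t + ln x) - t) \<le> 1 + \<bar>?g\<bar> + 2 * \<bar>ln x\<bar>"
      using eventually_ge_at_top[of 0]
    proof (eventually_elim, intro AE_unit)
      fix t x :: real assume "0 \<le> t" "0 < x" "x < 1"
      then have "\<bar>ln x\<bar> = - ln x" by simp
      then show "norm (Phi (t + ln x) - t) \<le> 1 + \<bar>?g\<bar> + 2 * \<bar>ln x\<bar>"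
        using Phi_ge[of "t + ln x"] Phi_le[of "t + ln x"] \<open>0 \<le> t\<close> unfolding real_norm_def by linarith
    qed
    show "integrable \<omega> (\<lambda>x. 1 + \<bar>?g\<bar> + 2 * \<bar>ln x\<bar>)" using ln_integrable by simp
  qed measurable
  then show ?thesis using ln_int Phi_integrable by (simp add: integrated_hit_prob_def[abs_def])
qed

text \<open>
  In the deficit identity, \<open>integrated_hit_prob t - t\<close> converges and the mean deficit is at most
  \<open>\<nu> / mean_X\<close>.
\<close>

lemma poisson_mean_linear: "\<exists>C. \<forall>\<^sub>F t in at_top. \<bar>poisson_mean t - t / \<mu>\<bar> \<le> C"
proof -
  let ?l = "euler_mascheroni + (\<integral>x. ln x \<partial>\<omega>)"
  have "\<forall>\<^sub>F t in at_top. dist (integrated_hit_prob t - t) ?l < 1"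
      by (rule tendstoD[OF integrated_hit_prob_asymp]) simp
  then have "\<forall>\<^sub>F t in at_top. \<bar>poisson_mean t - t / \<mu>\<bar> \<le> (\<bar>?l\<bar> + 1 + \<nu> / mean_X) / \<mu>"
  proof eventually_elim
    case (elim t)
    have "(\<integral>x. lag_deficit t (- ln (1 - x)) \<partial>\<omega>) \<le> (\<integral>x. (ln (1 - x))\<^sup>2 / mean_X \<partial>\<omega>)"
      using lag_deficit_bound_step square_integrable lag_deficit_integrable
      by (intro integral_mono_AE AE_unit) (auto simp: abs_le_iff)
    then have "(\<integral>x. lag_deficit t (- ln (1 - x)) \<partial>\<omega>) \<le> \<nu> / mean_X" by (simp add: \<nu>_def)
    moreover have "0 \<le> (\<integral>x. lag_deficit t (- ln (1 - x)) \<partial>\<omega>)" by (simp add: lag_deficit_nonneg)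
    ultimately have "\<bar>\<mu> * poisson_mean t - t\<bar> \<le> \<bar>?l\<bar> + 1 + \<nu> / mean_X"
      using elim lag_deficit_identity[of t] unfolding dist_real_def by linarith
    moreover have "\<mu> * poisson_mean t - t = \<mu> * (poisson_mean t - t / \<mu>)" using \<mu>_pos
        by (simp add: field_simps)
    ultimately have "\<bar>poisson_mean t - t / \<mu>\<bar> * \<mu> \<le> \<bar>?l\<bar> + 1 + \<nu> / mean_X"
      using \<mu>_pos by (simp only: abs_mult abs_of_pos mult.commute)
    then show ?case using \<mu>_pos by (simp only: pos_le_divide_eq)
  qed
  then show ?thesis by blast
qed

abbreviation step_law :: "real measure" where "step_law \<equiv> distr \<omega> borel (\<lambda>x. - ln (1 - x))"

text \<open>
  If the steps lay in \<open>{c * k | k}\<close>, then \<open>\<omega>\<close> would live on the geometric sequence with ratio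
  \<open>exp (- c)\<close>.
\<close>

lemma step_law_nonlattice:
  assumes c: "0 < c"
  shows "\<not> (AE s in step_law. \<exists>k::int. s = c * of_int k)"
proof
  have meas: "{s. \<exists>k::int. s = c * of_int k} \<in> sets borel"
  proof -
    have "{s. \<exists>k::int. s = c * of_int k} = (\<Union>k::int. {c * of_int k})" by auto
    also have "\<dots> \<in> sets borel" by (intro sets.countable_UN) auto
    finally show ?thesis .
  qed
  assume "AE s in step_law. \<exists>k::int. s = c * of_int k"
  then have "AE x in \<omega>. \<exists>k::int. - ln (1 - x) = c * of_int k"
    using meas by (subst (asm) AE_distr_iff) auto
  then have "AE x in \<omega>. x \<in> {1 - exp (- c) ^ j | j::nat. 1 \<le> j}"
    using unit
  proof eventually_elim
    case (elim x)
    then obtain k :: int where k: "- ln (1 - x) = c * of_int k" by blast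
    have "0 < - ln (1 - x)" using elim by simp
    then have "0 < k" using c by (simp add: k zero_less_mult_iff)
    have "ln (1 - x) = - c * real (nat k)" using k \<open>0 < k\<close> by simp
    moreover have "1 - x = exp (ln (1 - x))" using elim by simp
    ultimately have "1 - x = exp (- c * real (nat k))" by simp
    also have "\<dots> = exp (- c) ^ nat k" by (rule exp_of_nat2_mult)
    finally have "x = 1 - exp (- c) ^ nat k" by simp
    then show ?case using \<open>0 < k\<close> by (intro CollectI exI[of _ "nat k"]) auto
  qed
  moreover have "{1 - exp (- c) ^ j | j::nat. 1 \<le> j} \<in> sets \<omega>"
  proof -
    have "{1 - exp (- c) ^ j | j::nat. 1 \<le> j} = (\<Union>j\<in>{1::nat..}. {1 - exp (- c) ^ j})" by auto
    also have "\<dots> \<in> sets \<omega>" unfolding sets_\<omega> by (intro sets.countable_UN') auto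
    finally show ?thesis .
  qed
  ultimately have "measure \<omega> {1 - exp (- c) ^ j | j::nat. 1 \<le> j} = 1"
    by (subst prob_eq_1) auto
  with nonlattice c show False by force
qed

text \<open>
  The limsup bound is applied to the increment and to its negative. Its average over a progression with step
  \<open>d\<close> telescopes to one long increment of \<open>poisson_mean\<close>, known up to \<open>O(1)\<close>.
\<close>

lemma blackwell:
  assumes d: "0 < d"
  shows "((\<lambda>t. poisson_mean (t + d) - poisson_mean t) \<longlongrightarrow> d / \<mu>) at_top"
proof -
  let ?f = "\<lambda>t. poisson_mean (t + d) - poisson_mean t"
  obtain C where C: "\<forall>\<^sub>F t in at_top. \<bar>poisson_mean t - t / \<mu>\<bar> \<le> C" using poisson_mean_linear by blast
  have step_law_int: "(\<integral>s. ?f (t - s) \<partial>step_law)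
      = (\<integral>x. poisson_mean (t + d + ln (1 - x)) \<partial>\<omega>) - (\<integral>x. poisson_mean (t + ln (1 - x)) \<partial>\<omega>)" for t
  proof -
    have "(\<integral>s. ?f (t - s) \<partial>step_law) = (\<integral>x. ?f (t - - ln (1 - x)) \<partial>\<omega>)"
      by (subst integral_distr) auto
    also have "\<dots> = (\<integral>x. poisson_mean (t + d + ln (1 - x)) - poisson_mean (t + ln (1 - x)) \<partial>\<omega>)"
      by (intro Bochner_Integration.integral_cong) (auto simp: add_ac)
    also have "\<dots> = (\<integral>x. poisson_mean (t + d + ln (1 - x)) \<partial>\<omega>) - (\<integral>x. poisson_mean (t + ln (1 - x)) \<partial>\<omega>)"
      by (intro Bochner_Integration.integral_diff poisson_mean_shift_integrable)
    finally show ?thesis .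
  qed
  have harm: "((\<lambda>t. ?f t - (\<integral>s. ?f (t - s) \<partial>step_law)) \<longlongrightarrow> 0) at_top"
  proof -
    have "filterlim (\<lambda>t. t + d) at_top at_top" by real_asymp
    from tendsto_diff[OF filterlim_compose[OF hit_prob_tendsto_1 this] hit_prob_tendsto_1]
    have "((\<lambda>t. hit_prob (t + d) - hit_prob t) \<longlongrightarrow> 0) at_top" by simp
    moreover have "?f t - (\<integral>s. ?f (t - s) \<partial>step_law) = hit_prob (t + d) - hit_prob t" for t
      using poisson_mean_renewal[of "t + d"] poisson_mean_renewal[of t] unfolding step_law_int by simp
    ultimately show ?thesis by simp
  qed
  have lip: "\<bar>?f t - ?f s\<bar> \<le> 2 / mean_X * \<bar>t - s\<bar>" for t s
    using poisson_mean_lipschitz[of "t + d" "s + d"] poisson_mean_lipschitz[of t s] by simp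
  have bd: "\<bar>?f t\<bar> \<le> d / mean_X" for t using poisson_mean_lipschitz[of "t + d" t] d by simp
  interpret step: prob_space step_law by (rule prob_space_distr) simp
  interpret up: renewal_limit step_law ?f "d / mean_X" "2 / mean_X"
    by unfold_locales (use bd lip harm in simp_all)
  interpret down: renewal_limit step_law "\<lambda>t. - ?f t" "d / mean_X" "2 / mean_X"
  proof unfold_locales
    show "((\<lambda>t. - ?f t - (\<integral>s. - ?f (t - s) \<partial>step_law)) \<longlongrightarrow> 0) at_top"
    proof -
      have "- ?f t - (\<integral>s. - ?f (t - s) \<partial>step_law) = - (?f t - (\<integral>s. ?f (t - s) \<partial>step_law))" for t
        by (subst Bochner_Integration.integral_minus) simp
      then show ?thesis using tendsto_minus[OF harm] by (simp only: minus_zero)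
    qed
    show "\<bar>- ?f t - - ?f s\<bar> \<le> 2 / mean_X * \<bar>t - s\<bar>" for t s using lip[of t s] by simp
    show "\<bar>- ?f t\<bar> \<le> d / mean_X" for t using bd[of t] by simp
  qed simp
  have sum: "(\<Sum>i<N. ?f (t - real i * d)) = poisson_mean (t + d) - poisson_mean (t + d - real N * d)" for t N
  proof -
    have "(\<Sum>i<N. ?f (t - real i * d)) = (\<Sum>i<N. poisson_mean (t + d - real i * d) - poisson_mean (t
        + d - real (Suc i) * d))"
      by (intro sum.cong) (auto simp: algebra_simps)
    also have "\<dots> = poisson_mean (t + d) - poisson_mean (t + d - real N * d)"
        by (subst sum_lessThan_telescope') simp
    finally show ?thesis .
  qed
  have avg: "\<forall>\<^sub>F t in at_top. \<bar>(\<Sum>i<N. ?f (t - real i * d)) - real N * (d / \<mu>)\<bar> \<le> 2 * C" for N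
  proof -
    have "filterlim (\<lambda>t. t + d) at_top at_top" "filterlim (\<lambda>t. t + d - real N * d) at_top at_top"
        by real_asymp+
    from this[THEN eventually_compose_filterlim[OF C]] show ?thesis
    proof eventually_elim
      case (elim t)
      have eq: "(\<Sum>i<N. ?f (t - real i * d)) - real N * (d / \<mu>) =
        (poisson_mean (t + d) - (t + d) / \<mu>) - (poisson_mean (t + d - real N * d) - (t + d - real N * d) / \<mu>)"
        unfolding sum by (simp add: diff_divide_distrib)
      have "\<bar>(\<Sum>i<N. ?f (t - real i * d)) - real N * (d / \<mu>)\<bar> \<le>
        \<bar>poisson_mean (t + d) - (t + d) / \<mu>\<bar> + \<bar>poisson_mean (t + d - real N * d) - (t + d - real N * d) / \<mu>\<bar>"
        unfolding eq by (rule abs_triangle_ineq4)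
      also have "\<dots> \<le> C + C" using elim by (rule add_mono)
      finally show ?case by simp
    qed
  qed
  show ?thesis
  proof (rule order_tendstoI)
    fix e assume "d / \<mu> < e"
    moreover have "\<forall>\<^sub>F t in at_top. ?f t < d / \<mu> + (e - d / \<mu>)"
    proof (rule up.limsup_le_average[OF step_law_nonlattice d, where K="2 * C"])
      show "\<forall>\<^sub>F t in at_top. (\<Sum>i<N. ?f (t - real i * d)) \<le> real N * (d / \<mu>) + 2 * C" for N
        using avg[of N] by eventually_elim linarith
    qed (use \<open>d / \<mu> < e\<close> in simp_all)
    ultimately show "\<forall>\<^sub>F t in at_top. ?f t < e" by simp
  next
    fix e assume "e < d / \<mu>"
    moreover have "\<forall>\<^sub>F t in at_top. - ?f t < - (d / \<mu>) + (d / \<mu> - e)"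
    proof (rule down.limsup_le_average[OF step_law_nonlattice d, where K="2 * C"])
      show "\<forall>\<^sub>F t in at_top. (\<Sum>i<N. - ?f (t - real i * d)) \<le> real N * (- (d / \<mu>)) + 2 * C" for N
        unfolding sum_negf mult_minus_right using avg[of N]
      proof eventually_elim
        have "- s \<le> - r + k" if "\<bar>s - r\<bar> \<le> k" for s r k :: real using that by linarith
        then show "- (\<Sum>i<N. ?f (t - real i * d)) \<le> - (real N * (d / \<mu>)) + 2 * C"
          if "\<bar>(\<Sum>i<N. ?f (t - real i * d)) - real N * (d / \<mu>)\<bar> \<le> 2 * C" for t
          using that by blast
      qed
    qed (use \<open>e < d / \<mu>\<close> in simp_all)
    ultimately show "\<forall>\<^sub>F t in at_top. e < ?f t" by (auto elim!: eventually_mono)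
  qed
qed

text \<open>
  The integrand tends to \<open>s / \<mu>\<close> by \<open>blackwell\<close>, and the Lipschitz bound dominates it.
\<close>

lemma lag_deficit_tendsto:
  assumes y: "0 < y"
  shows "((\<lambda>t. lag_deficit t y) \<longlongrightarrow> y\<^sup>2 / (2 * \<mu>)) at_top"
proof -
  have "((\<lambda>t. \<integral>s. (poisson_mean t - poisson_mean (t - s)) * indicator {0..<y} s \<partial>lborel) \<longlongrightarrow>
      (\<integral>s. s / \<mu> * indicator {0..<y} s \<partial>lborel)) at_top"
  proof (rule integral_dominated_convergence_at_top[OF _ _ indicator_integrable[of "y / mean_X" y]])
    show "AE s in lborel. ((\<lambda>t. (poisson_mean t - poisson_mean (t - s)) * indicator {0..<y} s)
        \<longlongrightarrow> s / \<mu> * indicator {0..<y} s) at_top"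
    proof (rule AE_I2)
      fix s :: real
      consider "s < 0" | "s = 0" | "0 < s" by linarith
      then show "((\<lambda>t. (poisson_mean t - poisson_mean (t - s)) * indicator {0..<y} s)
          \<longlongrightarrow> s / \<mu> * indicator {0..<y} s) at_top"
      proof cases
        case 3
        have "filterlim (\<lambda>t. t - s) at_top at_top" by real_asymp
        from filterlim_compose[OF blackwell[OF 3] this] show ?thesis
            by (intro tendsto_mult tendsto_const) simp
      qed auto
    qed
    show "\<forall>\<^sub>F t in at_top. AE s in lborel. norm ((poisson_mean t - poisson_mean (t - s)) * indicator
        {0..<y} s) \<le> y / mean_X * indicator {0..<y} s"
      using lag_deficit_bound by simp
  qed measurable
  also have "(\<integral>s. s / \<mu> * indicator {0..<y} s \<partial>lborel) = (\<integral>s. s / \<mu> * indicator {0..y} s \<partial>lborel)"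
    by (intro integral_cong_AE) (auto simp: indicator_def
        intro!: eventually_mono[OF AE_lborel_singleton[of y]])
  also have "\<dots> = y\<^sup>2 / (2 * \<mu>) - 0\<^sup>2 / (2 * \<mu>)"
    using y \<mu>_pos by (intro integral_FTC_Icc_real) (auto intro!: derivative_eq_intros continuous_intros
        simp: field_simps)
  finally show ?thesis by (simp add: lag_deficit_def)
qed

theorem poisson_mean_asymp:
  "((\<lambda>t. poisson_mean t - t / \<mu>) \<longlongrightarrow> (euler_mascheroni + (\<integral>x. ln x \<partial>\<omega>)) / \<mu> + \<nu> / (2 * \<mu>\<^sup>2)) at_top"
proof -
  have "((\<lambda>t. \<integral>x. lag_deficit t (- ln (1 - x)) \<partial>\<omega>) \<longlongrightarrow> (\<integral>x. (ln (1 - x))\<^sup>2 / (2 * \<mu>) \<partial>\<omega>)) at_top"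
  proof (rule integral_dominated_convergence_at_top[where w="\<lambda>x. (ln (1 - x))\<^sup>2 / mean_X"])
    show "AE x in \<omega>. ((\<lambda>t. lag_deficit t (- ln (1 - x))) \<longlongrightarrow> (ln (1 - x))\<^sup>2 / (2 * \<mu>)) at_top"
    proof (rule AE_unit)
      fix x :: real assume "0 < x" "x < 1"
      then show "((\<lambda>t. lag_deficit t (- ln (1 - x))) \<longlongrightarrow> (ln (1 - x))\<^sup>2 / (2 * \<mu>)) at_top"
        using lag_deficit_tendsto[of "- ln (1 - x)"] by simp
    qed
    show "\<forall>\<^sub>F t in at_top. AE x in \<omega>. norm (lag_deficit t (- ln (1 - x))) \<le> (ln (1 - x))\<^sup>2 / mean_X"
      using lag_deficit_bound_step by (intro always_eventually allI AE_unit) simp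
    show "integrable \<omega> (\<lambda>x. (ln (1 - x))\<^sup>2 / mean_X)" using square_integrable by simp
  qed measurable
  then have "((\<lambda>t. \<integral>x. lag_deficit t (- ln (1 - x)) \<partial>\<omega>) \<longlongrightarrow> \<nu> / (2 * \<mu>)) at_top" by (simp add: \<nu>_def)
  from tendsto_divide[OF tendsto_add[OF integrated_hit_prob_asymp this] tendsto_const[of \<mu>]]
  have "((\<lambda>t. ((integrated_hit_prob t - t) + (\<integral>x. lag_deficit t (- ln (1 - x)) \<partial>\<omega>)) / \<mu>) \<longlongrightarrow>
      (euler_mascheroni + (\<integral>x. ln x \<partial>\<omega>) + \<nu> / (2 * \<mu>)) / \<mu>) at_top"
    using \<mu>_pos by simp
  moreover have "((integrated_hit_prob t - t) + (\<integral>x. lag_deficit t (- ln (1 - x)) \<partial>\<omega>)) / \<mu>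
      = poisson_mean t - t / \<mu>" for t
    using lag_deficit_identity[of t] \<mu>_pos by (simp add: field_simps)
  moreover have "(euler_mascheroni + (\<integral>x. ln x \<partial>\<omega>) + \<nu> / (2 * \<mu>)) / \<mu>
    = (euler_mascheroni + (\<integral>x. ln x \<partial>\<omega>)) / \<mu> + \<nu> / (2 * \<mu>\<^sup>2)"
    by (simp add: add_divide_distrib power2_eq_square)
  ultimately show ?thesis by simp
qed

end

section \<open>Comparison with the number of occupied intervals\<close>

lemma (in prob_space) indep_var_nn_integral:
  assumes indep: "indep_var S Y N W" and [measurable]: "g \<in> borel_measurable (S \<Otimes>\<^sub>M N)"
  shows "(\<integral>\<^sup>+s. g (Y s, W s) \<partial>M) = (\<integral>\<^sup>+s. \<integral>\<^sup>+w. g (Y s, w) \<partial>distr M N W \<partial>M)"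
proof -
  have [measurable]: "Y \<in> measurable M S" "W \<in> measurable M N"
    using indep_var_rv1[OF indep] indep_var_rv2[OF indep] by auto
  interpret W: prob_space "distr M N W" by (rule prob_space_distr) simp
  have "(\<integral>\<^sup>+s. g (Y s, W s) \<partial>M) = (\<integral>\<^sup>+z. g z \<partial>distr M (S \<Otimes>\<^sub>M N) (\<lambda>s. (Y s, W s)))"
    by (simp add: nn_integral_distr)
  also have "\<dots> = (\<integral>\<^sup>+z. g z \<partial>(distr M S Y \<Otimes>\<^sub>M distr M N W))"
    using indep by (simp add: indep_var_distribution_eq)
  also have "\<dots> = (\<integral>\<^sup>+y. \<integral>\<^sup>+w. g (y, w) \<partial>distr M N W \<partial>distr M S Y)"
    by (rule W.nn_integral_fst[symmetric]) simp
  also have "\<dots> = (\<integral>\<^sup>+s. \<integral>\<^sup>+w. g (Y s, w) \<partial>distr M N W \<partial>M)"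
    by (rule nn_integral_distr) measurable
  finally show ?thesis .
qed

text \<open>
  The points all miss the interval with probability \<open>(1 - (r - l)) ^ card B\<close>.
\<close>

lemma emeasure_PiM_uniform_hit:
  fixes B :: "'i set" and l r :: real
  assumes B: "finite B" and lr: "0 \<le> l" "l \<le> r" "r \<le> 1"
  defines "P \<equiv> PiM B (\<lambda>_. uniform_measure lborel {0..1::real})"
  shows "(\<integral>\<^sup>+w. indicator {w. \<exists>i\<in>B. w i \<in> {l<..<r}} w \<partial>P) = ennreal (1 - (1 - (r - l)) ^ card B)"
proof -
  interpret u: prob_space "uniform_measure lborel {0..1::real}"
    by (rule prob_space_uniform_measure) auto
  interpret P: product_prob_space "\<lambda>_. uniform_measure lborel {0..1::real}" B by unfold_locales
  interpret Pp: prob_space P unfolding P_def by (rule prob_space_PiM) unfold_locales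
  define S where "S = Pi\<^sub>E B (\<lambda>_. - {l<..<r})"
  have S: "S \<in> sets P" unfolding S_def P_def using B by (intro sets_PiM_I_finite) auto
  have "measure (uniform_measure lborel {0..1}) (- {l<..<r})
      = 1 - measure (uniform_measure lborel {0..1}) {l<..<r}"
    using u.prob_compl[of "{l<..<r}"] by (simp add: Compl_eq_Diff_UNIV)
  also have "measure (uniform_measure lborel {0..1}) {l<..<r} = r - l"
  proof -
    have "{0..1} \<inter> {l<..<r} = {l<..<r}" using lr by auto
    then show ?thesis using lr by (subst measure_uniform_measure) auto
  qed
  finally have "emeasure (uniform_measure lborel {0..1}) (- {l<..<r}) = ennreal (1 - (r - l))"
    by (simp add: u.emeasure_eq_measure)
  then have "emeasure P S = (\<Prod>i\<in>B. ennreal (1 - (r - l)))"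
    unfolding S_def P_def using B by (subst P.emeasure_PiM) auto
  also have "\<dots> = ennreal ((1 - (r - l)) ^ card B)" using lr by (simp add: ennreal_power)
  finally have "measure P S = (1 - (r - l)) ^ card B" using lr by (simp add: measure_def)
  then have "measure P (space P - S) = 1 - (1 - (r - l)) ^ card B" using Pp.prob_compl[OF S] by simp
  moreover have "(\<integral>\<^sup>+w. indicator {w. \<exists>i\<in>B. w i \<in> {l<..<r}} w \<partial>P) = (\<integral>\<^sup>+w. indicator (space P - S) w \<partial>P)"
    by (intro nn_integral_cong) (auto simp: indicator_def S_def P_def space_PiM PiE_iff)
  ultimately show ?thesis using S by (simp add: Pp.emeasure_eq_measure)
qed

lemma suminf_indicator_eq_card:
  fixes S :: "nat set"
  assumes "finite S"
  shows "(\<Sum>j. indicator S j :: ennreal) = ennreal (real (card S))"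
proof -
  have "(\<Sum>j. indicator S j :: ennreal) = emeasure (count_space UNIV) S"
    by (simp flip: nn_integral_count_space_nat)
  then show ?thesis using assms by (simp add: emeasure_count_space_finite ennreal_of_nat_eq_real_of_nat)
qed

locale stick_occupancy = stick_law \<omega> + M: prob_space M
  for \<omega> :: "real measure" and M :: "'a measure" +
  fixes X U :: "nat \<Rightarrow> 'a \<Rightarrow> real"
  assumes indep: "M.indep_vars (\<lambda>_. borel) (case_sum X U) ({1..} <+> {1..})"
    and X_distr: "\<And>i. 1 \<le> i \<Longrightarrow> distr M borel (X i) = \<omega>"
    and U_distr: "\<And>i. 1 \<le> i \<Longrightarrow> distr M borel (U i) = uniform_measure lborel {0..1}"
begin

lemma rv: "i \<in> {1..} <+> {1..} \<Longrightarrow> case_sum X U i \<in> borel_measurable M"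
  using indep by (simp add: M.indep_vars_def)

lemma X_measurable: "1 \<le> i \<Longrightarrow> X i \<in> borel_measurable M" using rv[of "Inl i"] by (auto simp: Plus_def)
lemma U_measurable: "1 \<le> i \<Longrightarrow> U i \<in> borel_measurable M" using rv[of "Inr i"] by (auto simp: Plus_def)

definition remainder :: "nat \<Rightarrow> 'a \<Rightarrow> real" where "remainder j s = (\<Prod>i=1..j. 1 - X i s)"

lemma remainder_0 [simp]: "remainder 0 s = 1" and remainder_Suc: "remainder (Suc j) s
    = remainder j s * (1 - X (Suc j) s)"
  by (simp_all add: remainder_def mult.commute)

lemma remainder_measurable [measurable]: "remainder j \<in> borel_measurable M"
  unfolding remainder_def[abs_def] using X_measurable
      by (intro borel_measurable_prod borel_measurable_diff) auto

lemma stick_point_eq: "stick_point (\<lambda>i. X i s) j = 1 - remainder j s"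
  by (simp add: stick_point_def remainder_def)

lemma AE_X: "AE s in M. \<forall>i\<ge>1. 0 < X i s \<and> X i s < 1"
proof -
  have "AE s in M. 0 < X i s \<and> X i s < 1" if "1 \<le> i" for i
    using unit unfolding X_distr[OF that, symmetric] using X_measurable[OF that]
    by (subst (asm) AE_distr_iff) auto
  then show ?thesis by (simp add: AE_all_countable)
qed

lemma AE_stick: "(\<And>s. \<forall>i\<ge>1. 0 < X i s \<and> X i s < 1 \<Longrightarrow> P s) \<Longrightarrow> AE s in M. P s"
  using AE_X by (rule eventually_mono)

lemma remainder_bounds:
  assumes "\<forall>i\<ge>1. 0 < X i s \<and> X i s < 1"
  shows "0 < remainder j s" "remainder j s \<le> 1"
proof -
  show "0 < remainder j s" unfolding remainder_def using assms by (intro prod_pos) auto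
  show "remainder j s \<le> 1" unfolding remainder_def using assms by (intro prod_le_1) (auto intro: less_imp_le)
qed

lemma indep_remainder_X: "M.indep_var borel (remainder j) borel (X (Suc j))"
proof -
  let ?A = "Inl ` {1..j} :: (nat + nat) set" and ?B = "{Inl (Suc j)} :: (nat + nat) set"
  have "M.indep_var (PiM ?A (\<lambda>_. borel)) (\<lambda>s. restrict (\<lambda>i. case_sum X U i s) ?A)
      (PiM ?B (\<lambda>_. borel)) (\<lambda>s. restrict (\<lambda>i. case_sum X U i s) ?B)"
    by (rule M.indep_var_restrict[OF indep]) auto
  then have "M.indep_var borel ((\<lambda>v. \<Prod>i=1..j. 1 - v (Inl i)) \<circ> (\<lambda>s. restrict (\<lambda>i. case_sum X U i s) ?A))
      borel ((\<lambda>v. v (Inl (Suc j))) \<circ> (\<lambda>s. restrict (\<lambda>i. case_sum X U i s) ?B))"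
    by (rule M.indep_var_compose)
      (auto intro!: borel_measurable_prod borel_measurable_diff measurable_component_singleton)
  also have "(\<lambda>v. \<Prod>i=1..j. 1 - v (Inl i)) \<circ> (\<lambda>s. restrict (\<lambda>i. case_sum X U i s) ?A) = remainder j"
    by (auto simp: fun_eq_iff remainder_def intro!: prod.cong)
  also have "(\<lambda>v. v (Inl (Suc j))) \<circ> (\<lambda>s. restrict (\<lambda>i. case_sum X U i s) ?B) = X (Suc j)"
    by (auto simp: fun_eq_iff)
  finally show ?thesis .
qed

lemma nn_integral_remainder_X:
  assumes "g \<in> borel_measurable (borel \<Otimes>\<^sub>M borel)"
  shows "(\<integral>\<^sup>+s. g (remainder j s, X (Suc j) s) \<partial>M) = (\<integral>\<^sup>+s. \<integral>\<^sup>+x. g (remainder j s, x) \<partial>\<omega> \<partial>M)"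
  using M.indep_var_nn_integral[OF indep_remainder_X assms] X_distr[of "Suc j"] by simp

text \<open>
  The last break is peeled off: it is independent of the earlier ones and averages to one application of
  \<open>step_mean\<close>.
\<close>

lemma nn_integral_ln_remainder:
  assumes "f \<in> borel_measurable borel"
  shows "(\<integral>\<^sup>+s. f (t + ln (remainder j s)) \<partial>M) = (step_mean ^^ j) f t"
  using assms
proof (induction j arbitrary: f)
  case 0
  then show ?case by (simp add: M.emeasure_space_1)
next
  case (Suc j)
  note [measurable] = Suc.prems
  have "(\<integral>\<^sup>+s. f (t + ln (remainder (Suc j) s)) \<partial>M)
      = (\<integral>\<^sup>+s. f (t + ln (remainder j s) + ln (1 - X (Suc j) s)) \<partial>M)"
  proof (intro nn_integral_cong_AE AE_stick)
    fix s assume elim: "\<forall>i\<ge>1. 0 < X i s \<and> X i s < 1"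
    then have "X (Suc j) s < 1" by simp
    then have "ln (remainder (Suc j) s) = ln (remainder j s) + ln (1 - X (Suc j) s)"
      unfolding remainder_Suc using remainder_bounds(1)[OF elim, of j] by (intro ln_mult_pos) auto
    then show "f (t + ln (remainder (Suc j) s)) = f (t + ln (remainder j s) + ln (1 - X (Suc j) s))"
        by (simp add: add.assoc)
  qed
  also have "\<dots> = (\<integral>\<^sup>+s. step_mean f (t + ln (remainder j s)) \<partial>M)"
    using nn_integral_remainder_X[of "\<lambda>(y, x). f (t + ln y + ln (1 - x))" j] by (simp add: step_mean_def)
  also have "\<dots> = (step_mean ^^ j) (step_mean f) t" by (rule Suc.IH) simp
  finally show ?case by (simp add: funpow_swap1)
qed

text \<open>
  Of the two lengths in \<open>n * (remainder j s * X (Suc j) s)\<close>, the last break is averaged into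
  \<open>hit_prob_nn\<close>, evaluated at the logarithm of \<open>n * remainder j s\<close>.
\<close>

lemma expectation_exp:
  assumes "0 < n"
  shows "(\<integral>\<^sup>+s. ennreal (1 - exp (- (real n * (remainder j s * X (Suc j) s)))) \<partial>M)
      = (step_mean ^^ j) hit_prob_nn (ln n)"
proof -
  have "(\<integral>\<^sup>+s. ennreal (1 - exp (- (real n * (remainder j s * X (Suc j) s)))) \<partial>M) =
    (\<integral>\<^sup>+s. \<integral>\<^sup>+x. ennreal (1 - exp (- (real n * (remainder j s * x)))) \<partial>\<omega> \<partial>M)"
    using nn_integral_remainder_X[of "\<lambda>(y, x). ennreal (1 - exp (- (real n * (y * x))))" j] by simp
  also have "\<dots> = (\<integral>\<^sup>+s. hit_prob_nn (ln n + ln (remainder j s)) \<partial>M)"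
  proof (intro nn_integral_cong_AE AE_stick)
    fix s assume elim: "\<forall>i\<ge>1. 0 < X i s \<and> X i s < 1"
    then show "(\<integral>\<^sup>+x. ennreal (1 - exp (- (real n * (remainder j s * x)))) \<partial>\<omega>)
        = hit_prob_nn (ln n + ln (remainder j s))"
      using remainder_bounds(1)[OF elim, of j] assms by (simp add: hit_prob_nn_def exp_add mult.assoc)
  qed
  also have "\<dots> = (step_mean ^^ j) hit_prob_nn (ln n)" by (rule nn_integral_ln_remainder) simp
  finally show ?thesis .
qed

text \<open>
  The block of the first breaks is independent of the block of the points, so the points may be integrated
  out for fixed interval ends.
\<close>

lemma occupied_probability:
  assumes n: "0 < n"
  shows "(\<integral>\<^sup>+s. indicator {s. \<exists>i\<in>{1..n}. U i s \<in> {1 - remainder j s<..<1 - remainder (Suc j) s}} s \<partial>M) =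
    (\<integral>\<^sup>+s. ennreal (1 - (1 - remainder j s * X (Suc j) s) ^ n) \<partial>M)"
proof -
  let ?A = "Inl ` {1..Suc j} :: (nat + nat) set" and ?B = "Inr ` {1..n} :: (nat + nat) set"
  let ?u = "uniform_measure lborel {0..1::real}"
  let ?V = "\<lambda>s. restrict (\<lambda>i. case_sum X U i s) ?A" and ?W = "\<lambda>s. restrict (\<lambda>i. case_sum X U i s) ?B"
  let ?q = "\<lambda>k v. \<Prod>i=1..k. 1 - v (Inl i :: nat + nat) :: real"
  have ind: "M.indep_var (PiM ?A (\<lambda>_. borel)) ?V (PiM ?B (\<lambda>_. borel)) ?W"
    by (rule M.indep_var_restrict[OF indep]) auto
  have q_V: "?q j (?V s) = remainder j s" "?q (Suc j) (?V s) = remainder (Suc j) s" for s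
    by (auto simp: remainder_def simp del: prod.cl_ivl_Suc intro!: prod.cong)
  have q_measurable: "?q k \<in> borel_measurable (PiM ?A (\<lambda>_. borel))" if "k \<le> Suc j" for k
    using that by (intro borel_measurable_prod borel_measurable_diff measurable_component_singleton) auto
  note [measurable] = q_measurable[of j, OF le_SucI[OF order.refl]] q_measurable[OF order.refl]
  have "M.indep_vars (\<lambda>_. borel) (case_sum X U) ?B"
    by (rule M.indep_vars_subset[OF indep]) auto
  then have "distr M (PiM ?B (\<lambda>_. borel)) ?W = PiM ?B (\<lambda>i. distr M borel (case_sum X U i))"
    using n U_measurable by (subst (asm) M.indep_vars_iff_distr_eq_PiM') auto
  also have "\<dots> = PiM ?B (\<lambda>_. ?u)"
    using U_distr by (intro PiM_cong) auto
  finally have W: "distr M (PiM ?B (\<lambda>_. borel)) ?W = PiM ?B (\<lambda>_. ?u)" .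
  let ?g = "\<lambda>(v, w). indicator {w. \<exists>i\<in>?B. w i \<in> {1 - ?q j v<..<1 - ?q (Suc j) v}} w :: ennreal"
  have g: "?g \<in> borel_measurable (PiM ?A (\<lambda>_. borel) \<Otimes>\<^sub>M PiM ?B (\<lambda>_. borel))"
  proof -
    have "?g = (\<lambda>z. if \<exists>i\<in>?B. 1 - ?q j (fst z) < snd z i \<and> snd z i < 1 - ?q (Suc j) (fst z) then 1 else 0)"
      by (auto simp: fun_eq_iff indicator_def)
    also have "\<dots> \<in> borel_measurable (PiM ?A (\<lambda>_. borel) \<Otimes>\<^sub>M PiM ?B (\<lambda>_. borel))"
      by measurable
    finally show ?thesis .
  qed
  have "(\<integral>\<^sup>+s. indicator {s. \<exists>i\<in>{1..n}. U i s \<in> {1 - remainder j s<..<1 - remainder (Suc j) s}} s \<partial>M) =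
    (\<integral>\<^sup>+s. ?g (?V s, ?W s) \<partial>M)"
    unfolding prod.case q_V by (intro nn_integral_cong) (auto simp: indicator_def)
  also have "\<dots> = (\<integral>\<^sup>+s. \<integral>\<^sup>+w. ?g (?V s, w) \<partial>PiM ?B (\<lambda>_. ?u) \<partial>M)"
    unfolding W[symmetric] by (rule M.indep_var_nn_integral[OF ind g])
  also have "\<dots> = (\<integral>\<^sup>+s. ennreal (1 - (1 - remainder j s * X (Suc j) s) ^ n) \<partial>M)"
  proof (intro nn_integral_cong_AE AE_stick)
    fix s assume elim: "\<forall>i\<ge>1. 0 < X i s \<and> X i s < 1"
    have "0 < X (Suc j) s" using elim by simp
    then have "remainder (Suc j) s \<le> remainder j s" unfolding remainder_Suc
        using remainder_bounds(1)[OF elim, of j] by (simp add: mult_le_cancel_left1)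
    then have "(\<integral>\<^sup>+w. indicator {w. \<exists>i\<in>?B. w i \<in> {1 - remainder j s<..<1 - remainder (Suc j) s}} w \<partial>PiM ?B
        (\<lambda>_. ?u)) =
      ennreal (1 - (1 - ((1 - remainder (Suc j) s) - (1 - remainder j s))) ^ card ?B)"
      using remainder_bounds[OF elim] by (intro emeasure_PiM_uniform_hit) (auto simp: less_imp_le)
    also have "(1 - remainder (Suc j) s) - (1 - remainder j s) = remainder j s * X (Suc j) s"
        unfolding remainder_Suc by (simp add: algebra_simps)
    also have "card ?B = n" by (simp add: card_image)
    finally show "(\<integral>\<^sup>+w. ?g (?V s, w) \<partial>PiM ?B (\<lambda>_. ?u)) = ennreal (1 - (1 - remainder j s * X (Suc j) s) ^ n)"
      unfolding prod.case q_V .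
  qed
  finally show ?thesis .
qed

abbreviation K :: "nat \<Rightarrow> 'a \<Rightarrow> nat" where
  "K n s \<equiv> num_occupied (\<lambda>i. X i s) (\<lambda>i. U i s) n"

definition occ :: "nat \<Rightarrow> 'a \<Rightarrow> nat set" where
  "occ n s = {j. 1 \<le> j \<and> (\<exists>i\<in>{1..n}. U i s \<in> {1 - remainder (j - 1) s<..<1 - remainder j s})}"

lemma K_eq: "K n s = card (occ n s)"
  by (simp add: num_occupied_def occ_def stick_point_eq)

lemma occ_measurable: "{s \<in> space M. j \<in> occ n s} \<in> sets M"
proof -
  have "Measurable.pred M (\<lambda>s. \<exists>i\<in>{1..n}. 1 - remainder (j - 1) s < U i s \<and> U i s < 1 - remainder j s)"
  proof (rule pred_intros_finite(4))
    fix i assume "i \<in> {1..n}"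
    then have [measurable]: "U i \<in> borel_measurable M" by (intro U_measurable) simp
    show "Measurable.pred M (\<lambda>s. 1 - remainder (j - 1) s < U i s \<and> U i s < 1 - remainder j s)" by measurable
  qed simp
  then show ?thesis by (cases "1 \<le> j") (simp_all add: occ_def pred_def)
qed

lemma K_measurable [measurable]: "(\<lambda>s. real (K n s)) \<in> borel_measurable M"
  unfolding K_eq by (intro measurable_compose[OF measurable_card[OF occ_measurable]]) simp

text \<open>
  Each of the finitely many points lies in at most one interval, as the intervals are disjoint.
\<close>

lemma finite_occ:
  assumes X: "\<forall>i\<ge>1. 0 < X i s \<and> X i s < 1"
  shows "finite (occ n s)"
proof -
  have remainder_dec: "remainder k s \<le> remainder j s" if "j \<le> k" for j k
    using that
  proof (induction k rule: dec_induct)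
    case (step k)
    have "0 < X (Suc k) s" using X by simp
    then have "remainder (Suc k) s \<le> remainder k s" unfolding remainder_Suc
        using remainder_bounds(1)[OF X, of k] by (simp add: mult_le_cancel_left1)
    with step show ?case by simp
  qed simp
  have "finite {j. 1 \<le> j \<and> u \<in> {1 - remainder (j - 1) s<..<1 - remainder j s}}" (is "finite ?J") for u
  proof -
    have "j = k" if "j \<in> ?J" "k \<in> ?J" for j k
    proof (rule ccontr)
      assume "j \<noteq> k"
      then consider "j \<le> k - 1" | "k \<le> j - 1" using that by fastforce
      then show False using remainder_dec[of j "k - 1"] remainder_dec[of k "j - 1"] that by cases auto
    qed
    then have "?J \<subseteq> {j}" if "j \<in> ?J" for j using that by blast
    then show ?thesis by (cases "?J = {}") (auto intro: finite_subset)
  qed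
  then have "finite (\<Union>i\<in>{1..n}. {j. 1 \<le> j \<and> U i s \<in> {1 - remainder (j - 1) s<..<1 - remainder j s}})" by blast
  then show ?thesis by (rule rev_finite_subset) (auto simp: occ_def)
qed

lemma nn_integral_K:
  assumes n: "0 < n"
  shows "(\<integral>\<^sup>+s. ennreal (real (K n s)) \<partial>M)
      = (\<Sum>j. \<integral>\<^sup>+s. ennreal (1 - (1 - remainder j s * X (Suc j) s) ^ n) \<partial>M)"
proof -
  have "(\<integral>\<^sup>+s. ennreal (real (K n s)) \<partial>M) = (\<integral>\<^sup>+s. (\<Sum>j. indicator (occ n s) j) \<partial>M)"
    by (intro nn_integral_cong_AE AE_stick) (simp add: K_eq suminf_indicator_eq_card finite_occ)
  also have "\<dots> = (\<integral>\<^sup>+s. (\<Sum>j. indicator {s. j \<in> occ n s} s) \<partial>M)"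
    by (simp add: indicator_def)
  also have "\<dots> = (\<Sum>j. \<integral>\<^sup>+s. indicator {s. j \<in> occ n s} s \<partial>M)"
  proof (rule nn_integral_suminf)
    fix j
    have "(\<lambda>s. indicator {s \<in> space M. j \<in> occ n s} s) \<in> borel_measurable M"
      using occ_measurable by measurable
    then show "(\<lambda>s. indicator {s. j \<in> occ n s} s :: ennreal) \<in> borel_measurable M"
      by (rule measurable_cong[THEN iffD1, rotated]) (auto simp: indicator_def)
  qed
  also have "\<dots> = (\<Sum>j. \<integral>\<^sup>+s. indicator {s. Suc j \<in> occ n s} s \<partial>M)"
    by (subst suminf_offset[of _ 1]) (auto simp: occ_def)
  also have "\<dots> = (\<Sum>j. \<integral>\<^sup>+s. ennreal (1 - (1 - remainder j s * X (Suc j) s) ^ n) \<partial>M)"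
  proof (intro arg_cong[of _ _ suminf] ext)
    fix j
    show "(\<integral>\<^sup>+s. indicator {s. Suc j \<in> occ n s} s \<partial>M)
        = (\<integral>\<^sup>+s. ennreal (1 - (1 - remainder j s * X (Suc j) s) ^ n) \<partial>M)"
      unfolding occupied_probability[OF n, symmetric]
          by (intro nn_integral_cong) (auto simp: occ_def indicator_def)
  qed
  finally show ?thesis .
qed

lemma nn_integral_K_sandwich:
  assumes n: "0 < n"
  shows "poisson_mean_nn (ln n) \<le> (\<integral>\<^sup>+s. ennreal (real (K n s)) \<partial>M)"
    and "(\<integral>\<^sup>+s. ennreal (real (K n s)) \<partial>M) \<le> ennreal (1 + 2 / n) * poisson_mean_nn (ln n)"
proof -
  define c where "c = 1 + 2 / real n"
  have c: "0 \<le> c" by (simp add: c_def)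
  have p: "0 \<le> real n * (remainder j s * X (Suc j) s)" "real n * (remainder j s * X (Suc j) s) \<le> real n"
    if "\<forall>i\<ge>1. 0 < X i s \<and> X i s < 1" for j s
  proof -
    have "0 < X (Suc j) s" "X (Suc j) s < 1" using that by auto
    then show "0 \<le> real n * (remainder j s * X (Suc j) s)" using remainder_bounds[OF that, of j] by simp
    have "remainder j s * X (Suc j) s \<le> 1"
        using remainder_bounds[OF that, of j] \<open>0 < X (Suc j) s\<close> \<open>X (Suc j) s < 1\<close> by (intro mult_le_one) auto
    then show "real n * (remainder j s * X (Suc j) s) \<le> real n" using n by simp
  qed
  have [measurable]: "X (Suc j) \<in> borel_measurable M" for j by (rule X_measurable) simp
  have low: "(step_mean ^^ j) hit_prob_nn (ln n)
      \<le> (\<integral>\<^sup>+s. ennreal (1 - (1 - remainder j s * X (Suc j) s) ^ n) \<partial>M)" for j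
    unfolding expectation_exp[OF n, symmetric]
  proof (intro nn_integral_mono_AE AE_stick)
    fix s assume elim: "\<forall>i\<ge>1. 0 < X i s \<and> X i s < 1"
    show "ennreal (1 - exp (- (real n * (remainder j s * X (Suc j) s))))
        \<le> ennreal (1 - (1 - remainder j s * X (Suc j) s) ^ n)"
      using power_exp_sandwich(1)[OF p[OF elim, of j] n] n by (intro ennreal_leI) simp
  qed
  have up: "(\<integral>\<^sup>+s. ennreal (1 - (1 - remainder j s * X (Suc j) s) ^ n) \<partial>M)
      \<le> ennreal c * (step_mean ^^ j) hit_prob_nn (ln n)" for j
  proof -
    have "(\<integral>\<^sup>+s. ennreal (1 - (1 - remainder j s * X (Suc j) s) ^ n) \<partial>M) \<le>
      (\<integral>\<^sup>+s. ennreal c * ennreal (1 - exp (- (real n * (remainder j s * X (Suc j) s)))) \<partial>M)"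
      proof (intro nn_integral_mono_AE AE_stick)
      fix s assume elim: "\<forall>i\<ge>1. 0 < X i s \<and> X i s < 1"
      show "ennreal (1 - (1 - remainder j s * X (Suc j) s) ^ n) \<le>
          ennreal c * ennreal (1 - exp (- (real n * (remainder j s * X (Suc j) s))))"
        using power_exp_sandwich(2)[OF p[OF elim, of j] n] n c p[OF elim, of j] unfolding c_def[symmetric]
        by (simp add: ennreal_leI flip: ennreal_mult)
    qed
    then show ?thesis by (simp add: nn_integral_cmult expectation_exp[OF n])
  qed
  show "poisson_mean_nn (ln n) \<le> (\<integral>\<^sup>+s. ennreal (real (K n s)) \<partial>M)"
    unfolding nn_integral_K[OF n] poisson_mean_nn_def by (intro suminf_le low) auto
  have "(\<integral>\<^sup>+s. ennreal (real (K n s)) \<partial>M) \<le> (\<Sum>j. ennreal c * (step_mean ^^ j) hit_prob_nn (ln n))"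
    unfolding nn_integral_K[OF n] by (intro suminf_le up) auto
  then show "(\<integral>\<^sup>+s. ennreal (real (K n s)) \<partial>M) \<le> ennreal (1 + 2 / n) * poisson_mean_nn (ln n)"
    by (simp add: poisson_mean_nn_def c_def)
qed

lemma mean_occupied_sandwich:
  assumes n: "0 < n"
  shows "poisson_mean (ln n) \<le> (\<integral>s. real (K n s) \<partial>M)"
    and "(\<integral>s. real (K n s) \<partial>M) \<le> (1 + 2 / n) * poisson_mean (ln n)"
proof -
  define c where "c = 1 + 2 / real n"
  have c: "0 \<le> c" by (simp add: c_def)
  let ?I = "\<integral>\<^sup>+s. ennreal (real (K n s)) \<partial>M"
  have I: "ennreal (poisson_mean (ln n)) \<le> ?I" "?I \<le> ennreal (c * poisson_mean (ln n))"
    using nn_integral_K_sandwich[OF n] c poisson_mean_nonneg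
        by (simp_all add: poisson_mean_nn_eq ennreal_mult c_def[symmetric])
  then have fin: "?I < \<top>" by (meson ennreal_less_top le_less_trans)
  have mean: "(\<integral>s. real (K n s) \<partial>M) = enn2real ?I"
    by (rule integral_eq_nn_integral) auto
  have "enn2real (ennreal (poisson_mean (ln n))) \<le> enn2real ?I" using I(1) fin by (intro enn2real_mono)
  then show "poisson_mean (ln n) \<le> (\<integral>s. real (K n s) \<partial>M)" by (simp add: mean poisson_mean_nonneg)
  have "enn2real ?I \<le> enn2real (ennreal (c * poisson_mean (ln n)))" using I(2) by (intro enn2real_mono) auto
  then show "(\<integral>s. real (K n s) \<partial>M) \<le> (1 + 2 / n) * poisson_mean (ln n)"
    using c poisson_mean_nonneg[of "ln n"] by (simp add: mean c_def)
qed

end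

theorem proposition5:
  fixes \<omega> :: "real measure"
    and M :: "'a measure"
    and X U :: "nat \<Rightarrow> 'a \<Rightarrow> real"
    and a :: "nat \<Rightarrow> real"
    and \<mu> \<nu> b :: real
  assumes "prob_space \<omega>" and "sets \<omega> = sets borel" and "measure \<omega> {0<..<1} = 1"
    and nongeometric: "\<not> (\<exists>x\<in>{0<..<1}. measure \<omega> {1 - x ^ j | j::nat. 1 \<le> j} = 1)"
    and "integrable \<omega> (\<lambda>x. \<bar>ln x\<bar>)"
    and "integrable \<omega> (\<lambda>x. (ln (1 - x))\<^sup>2)"
    and "\<nu> = (\<integral>x. (ln (1 - x))\<^sup>2 \<partial>\<omega>)"
    and "\<mu> = (\<integral>x. \<bar>ln (1 - x)\<bar> \<partial>\<omega>)"
    and "prob_space M"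
    and X_U_indep: "prob_space.indep_vars M (\<lambda>_. borel) (case_sum X U) ({1..} <+> {1..})"
    and X_distr: "\<And>i. 1 \<le> i \<Longrightarrow> distr M borel (X i) = \<omega>"
    and U_distr: "\<And>i. 1 \<le> i \<Longrightarrow> distr M borel (U i) = uniform_measure lborel {0..1}"
    and "\<And>n. a n = (\<integral>s. real (num_occupied (\<lambda>i. X i s) (\<lambda>i. U i s) n) \<partial>M)"
    and "b = 1 / \<mu> * (\<integral>x. ln x \<partial>\<omega>) + \<nu> / (2 * \<mu>\<^sup>2)"
  shows "(\<lambda>n. a n - (ln (real n) / \<mu> + euler_mascheroni / \<mu> + b)) \<in> o(\<lambda>_. 1)"
proof -
  interpret W: prob_space \<omega> by fact
  interpret Mp: prob_space M by fact
  have unit: "AE x in \<omega>. 0 < x \<and> x < 1"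
    using W.AE_prob_1[OF \<open>measure \<omega> {0<..<1} = 1\<close>] by simp
  interpret R: stick_law_moments \<omega>
    by unfold_locales (use assms(2,4-6) unit in auto)
  interpret S: stick_occupancy \<omega> M X U
    by unfold_locales (use X_U_indep X_distr U_distr in auto)
  have params: "R.\<mu> = \<mu>" "R.\<nu> = \<nu>" using assms(7,8) by (simp_all add: R.\<mu>_def R.\<nu>_def)
  define d where "d n = R.poisson_mean (ln (real n)) - ln (real n) / \<mu>" for n :: nat
  let ?l = "euler_mascheroni / \<mu> + b"
  have l: "(euler_mascheroni + (\<integral>x. ln x \<partial>\<omega>)) / \<mu> + \<nu> / (2 * \<mu>\<^sup>2) = ?l"
    using assms(14) by (simp add: add_divide_distrib)
  have "filterlim (\<lambda>n. ln (real n)) at_top sequentially" by real_asymp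
  from filterlim_compose[OF R.poisson_mean_asymp this] have d_lim: "d \<longlonglongrightarrow> ?l"
    unfolding params l d_def[abs_def] .
  have "(\<lambda>n. d n + 2 / real n * d n + 2 * ln (real n) / real n * (1 / \<mu>)) \<longlonglongrightarrow> ?l + 0 * ?l + 0 * (1 / \<mu>)"
    by (intro tendsto_add tendsto_mult d_lim tendsto_const) real_asymp+
  then have upper: "(\<lambda>n. d n + 2 / real n * d n + 2 * ln (real n) / real n * (1 / \<mu>)) \<longlonglongrightarrow> ?l" by simp
  have "(\<lambda>n. a n - ln (real n) / \<mu>) \<longlonglongrightarrow> ?l"
  proof (rule tendsto_sandwich[OF _ _ d_lim upper])
    show "\<forall>\<^sub>F n in sequentially. d n \<le> a n - ln (real n) / \<mu>"
      using eventually_gt_at_top[of 0]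
      by eventually_elim (use S.mean_occupied_sandwich(1) assms(13) in \<open>simp add: d_def\<close>)
    show "\<forall>\<^sub>F n in sequentially. a n - ln (real n) / \<mu>
        \<le> d n + 2 / real n * d n + 2 * ln (real n) / real n * (1 / \<mu>)"
      using eventually_gt_at_top[of 0]
    proof eventually_elim
      case (elim n)
      have "d n + 2 / real n * d n + 2 * ln (real n) / real n * (1 / \<mu>) =
        (1 + 2 / real n) * R.poisson_mean (ln (real n)) - ln (real n) / \<mu>"
        by (simp add: d_def algebra_simps)
      then show ?case using S.mean_occupied_sandwich(2)[OF elim] assms(13) by simp
    qed
  qed
  from tendsto_diff[OF this tendsto_const[of ?l]]
  have "(\<lambda>n. a n - (ln (real n) / \<mu> + euler_mascheroni / \<mu> + b)) \<longlonglongrightarrow> 0"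
    by (simp add: algebra_simps)
  then show ?thesis by (intro smalloI_tendsto) auto
qed

end
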